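(* Let $q$ be a complex number with $0<|q|<1$. Define sequences $(A_m)_{m\ge 0}$ and $(B_m)_{m\ge 0}$ by $$A_m=-q^{2m-3}A_{m-1}+(1+q^{2m-4})A_{m-2}\quad(m\ge 2),\qquad A_0=0,\ A_1=1,$$ $$B_m=-q^{2m-3}B_{m-1}+(1+q^{2m-4})B_{m-2}\quad(m\ge 2),\qquad B_0=-\tfrac12,\ B_1=0.$$ Then for every integer $m\ge 0$, $$\sum_{n=0}^{\infty}\frac{(-q;q^2)_n q^{n^2+2mn}}{(q^4;q^4)_n}=\frac{(q^6;q^6)_{\infty}}{(-q^2;q^2)_{m-1}(q^4;q^4)_{\infty}(q^3,q^9;q^{12})_{\infty}}A_m-\frac{(q^3,q^3,q^6;q^6)_{\infty}(-q;q^2)_{\infty}}{(-q^2;q^2)_{m-1}(q^2;q^2)_{\infty}}B_m.$$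
   Context: For $|p|<1$, $(a;p)_\infty=\prod_{k=0}^{\infty}(1-ap^k)$ and $(a;p)_n=(a;p)_\infty/(ap^n;p)_\infty$ for every integer $n$ (also negative); thus $(a;p)_n=\prod_{k=0}^{n-1}(1-ap^k)$ for $n\ge 0$, and in particular $(-q^2;q^2)_{-1}=1/2$. Multiple $q$-shifted factorials are products: $(a_1,\dots,a_r;p)_\infty=(a_1;p)_\infty\cdots(a_r;p)_\infty$. *)

theory Defs
  imports "HOL-Analysis.Analysis"
begin

text \<open>
  The q-shifted factorials \<open>(a; p)\<^sub>\<infinity>\<close> are only meaningful for \<open>norm p < 1\<close>, where the product
  converges; \<^const>\<open>prodinf\<close> takes the value \<open>0\<close> if a factor vanishes.
\<close>

definition qpoch_inf :: "complex \<Rightarrow> complex \<Rightarrow> complex" where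
  "qpoch_inf a p = (\<Prod>k. 1 - a * p ^ k)"

text \<open>\<open>(a\<^sub>1, \<dots>, a\<^sub>r; p)\<^sub>\<infinity>\<close>\<close>

definition qpoch_inf_multi :: "complex list \<Rightarrow> complex \<Rightarrow> complex" where
  "qpoch_inf_multi as p = (\<Prod>a\<leftarrow>as. qpoch_inf a p)"

text \<open>
  \<open>(a; p)\<^sub>n\<close> for an arbitrary integer \<open>n\<close>. Being a quotient, it is the intended value only when
  \<open>p \<noteq> 0\<close> and no factor \<open>1 - a p\<^bsup>n+k\<^esup>\<close> (\<open>k \<ge> 0\<close>) of the denominator vanishes.
\<close>

definition qpoch :: "complex \<Rightarrow> complex \<Rightarrow> int \<Rightarrow> complex" where
  "qpoch a p n = qpoch_inf a p / qpoch_inf (a * p powi n) p"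

end

theory Submission
  imports Defs
begin

text \<open>
  Write \<open>S\<^sub>m\<close> for the series. Comparing coefficients gives
  \<open>S\<^sub>m = q\<^bsup>2m+1\<^esup> S\<^sub>m\<^sub>+\<^sub>1 + (1 + q\<^bsup>2m+2\<^esup>) S\<^sub>m\<^sub>+\<^sub>2\<close>, so that \<open>(-q\<^sup>2; q\<^sup>2)\<^sub>m\<^sub>-\<^sub>1 S\<^sub>m\<close> satisfies the
  recurrence of \<open>A\<close> and \<open>B\<close>, and only \<open>S\<^sub>0\<close> and \<open>S\<^sub>1\<close> have to be evaluated. For both the
  sequence \<open>1 / (q\<^sup>4; q\<^sup>4)\<^sub>n\<close> is the \<open>\<beta>\<close>-part of a Bailey pair in base \<open>q\<^sup>2\<close>, relative to \<open>1\<close> and \<open>q\<^sup>2\<close>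
  respectively. Bailey's lemma with the parameter \<open>-q\<close> turns the series into theta series, which the
  Jacobi triple product evaluates; for \<open>S\<^sub>1\<close> the factor \<open>1 - q\<^bsup>4r+2\<^esup>\<close> of the \<open>\<alpha>\<close>-part cancels the
  denominator \<open>1 + q\<^bsup>2r+1\<^esup>\<close>. All sums are first finite, and the limit is taken by dominated
  convergence.
\<close>

section \<open>Finite and infinite shifted factorials\<close>

text \<open>The finite product behind \<open>qpoch\<close> at a natural index: free of the quotient
  of infinite products, so the finite identities can be proved by induction;
  \<open>qpoch_eq_qfac\<close> translates back.\<close>

definition qfac :: "complex \<Rightarrow> complex \<Rightarrow> nat \<Rightarrow> complex" where
  "qfac a p n = (\<Prod>k<n. 1 - a * p ^ k)"

lemma qfac_0 [simp]: "qfac a p 0 = 1"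
  by (simp add: qfac_def)

lemma qfac_Suc: "qfac a p (Suc n) = qfac a p n * (1 - a * p ^ n)"
  by (simp add: qfac_def)

lemma qfac_add: "qfac a p (m + n) = qfac a p m * qfac (a * p ^ m) p n"
  by (induction n) (simp_all add: qfac_Suc power_add algebra_simps)

lemma qfac_Suc_shift: "qfac a p (Suc n) = (1 - a) * qfac (a * p) p n"
  using qfac_add[of a p 1 n] by (simp add: qfac_Suc)

lemma qfac_nonzero:
  assumes "norm a < 1" "norm p < 1"
  shows "qfac a p n \<noteq> 0"
proof -
  have "1 - a * p ^ k \<noteq> 0" for k
  proof
    assume "1 - a * p ^ k = 0"
    then have "norm a * norm p ^ k = 1"
      by (metis eq_iff_diff_eq_0 norm_mult norm_one norm_power)
    moreover have "norm p ^ k \<le> 1"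
      using assms by (simp add: power_le_one)
    then have "norm a * norm p ^ k \<le> norm a"
      by (simp add: mult_left_le)
    ultimately show False using assms by simp
  qed
  then show ?thesis unfolding qfac_def by (subst prod_zero_iff) blast+
qed

text \<open>Expresses a reciprocal as a polynomial multiple of the next one, so that the Bailey pair
  proofs can treat reciprocals as atoms in polynomial identities.\<close>

lemma inverse_qfac_Suc:
  assumes "norm p < 1"
  shows "inverse (qfac p p k) = (1 - p * p ^ k) * inverse (qfac p p (Suc k))"
proof -
  have "1 - p * p ^ k \<noteq> 0"
    using qfac_nonzero[OF assms assms, of "Suc k"] by (simp add: qfac_Suc)
  then have "x = (1 - p * p ^ k) * (x * inverse (1 - p * p ^ k))" for x by simp
  then show ?thesis unfolding qfac_Suc inverse_mult_distrib .
qed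

section \<open>Infinite shifted factorials: convergence, nonvanishing, splitting and
  dissection\<close>

lemma convergent_prod_qpoch:
  fixes a p :: complex
  assumes "norm p < 1"
  shows "convergent_prod (\<lambda>k. 1 - a * p ^ k)"
proof -
  have "summable (\<lambda>k. norm ((1 - a * p ^ k) - 1))"
    using assms by (simp add: norm_mult norm_power summable_mult summable_geometric)
  then show ?thesis
    by (intro abs_convergent_prod_imp_convergent_prod) (simp add: abs_convergent_prod_conv_summable)
qed

lemma qfac_tendsto:
  assumes "norm p < 1"
  shows "qfac a p \<longlonglongrightarrow> qpoch_inf a p"
proof -
  have "(\<lambda>n. \<Prod>k\<le>n. 1 - a * p ^ k) \<longlonglongrightarrow> qpoch_inf a p"
    unfolding qpoch_inf_def by (rule convergent_prod_LIMSEQ[OF convergent_prod_qpoch[OF assms]])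
  then have "(\<lambda>n. qfac a p (Suc n)) \<longlonglongrightarrow> qpoch_inf a p"
    by (simp add: qfac_def lessThan_Suc_atMost del: prod.lessThan_Suc)
  then show ?thesis by (rule LIMSEQ_imp_Suc)
qed

lemma qpoch_inf_nonzero:
  assumes "norm a < 1" "norm p < 1"
  shows "qpoch_inf a p \<noteq> 0"
proof -
  have "1 - a * p ^ k \<noteq> 0" for k
    using qfac_nonzero[OF assms, of "Suc k"] by (simp add: qfac_Suc)
  then show ?thesis unfolding qpoch_inf_def
    by (intro prodinf_nonzero convergent_prod_qpoch assms)
qed

lemma qpoch_inf_split:
  assumes "norm p < 1"
  shows "qpoch_inf a p = qfac a p n * qpoch_inf (a * p ^ n) p"
proof (rule LIMSEQ_unique)
  show "(\<lambda>k. qfac a p (k + n)) \<longlonglongrightarrow> qpoch_inf a p"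
    by (rule LIMSEQ_ignore_initial_segment[OF qfac_tendsto[OF assms]])
  have "(\<lambda>k. qfac a p n * qfac (a * p ^ n) p k) \<longlonglongrightarrow> qfac a p n * qpoch_inf (a * p ^ n) p"
    by (intro tendsto_intros qfac_tendsto assms)
  then show "(\<lambda>k. qfac a p (k + n)) \<longlonglongrightarrow> qfac a p n * qpoch_inf (a * p ^ n) p"
    by (subst add.commute) (simp add: qfac_add)
qed

lemma qpoch_eq_qfac:
  assumes "norm a < 1" "norm p < 1"
  shows "qpoch a p (int n) = qfac a p n"
proof -
  have "norm (a * p ^ n) < 1"
  proof -
    have "norm p ^ n \<le> 1" using assms by (simp add: power_le_one)
    then have "norm a * norm p ^ n \<le> norm a" by (simp add: mult_left_le)
    then show ?thesis using assms by (simp add: norm_mult norm_power)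
  qed
  then have "qpoch_inf (a * p ^ n) p \<noteq> 0" by (rule qpoch_inf_nonzero) fact
  then show ?thesis
    unfolding qpoch_def using qpoch_inf_split[OF assms(2), of a n] by simp
qed

text \<open>The denominator becomes (-1; p)_inf, whose first factor is 2 and whose other factors
  form (-p; p)_inf. This is the prefactor in the case \<open>m = 0\<close> of the theorem.\<close>

lemma qpoch_minus_one:
  assumes "p \<noteq> 0" "norm p < 1"
  shows "qpoch (- p) p (- 1) = 1 / 2"
proof -
  have "qpoch_inf (- 1) p = 2 * qpoch_inf (- p) p"
    using qpoch_inf_split[OF assms(2), of "- 1" 1] by (simp add: qfac_Suc)
  moreover have "qpoch_inf (- p) p \<noteq> 0" using assms by (intro qpoch_inf_nonzero) auto
  ultimately show ?thesis using assms by (simp add: qpoch_def power_int_minus)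
qed

text \<open>Even and odd exponents are separated in the finite products with an even number of
  factors; this subsequence determines the limit.\<close>

lemma qpoch_inf_dissect2:
  assumes "norm p < 1"
  shows "qpoch_inf a p = qpoch_inf a (p ^ 2) * qpoch_inf (a * p) (p ^ 2)"
proof (rule LIMSEQ_unique)
  have p2: "norm (p ^ 2) < 1"
    using assms by (simp add: norm_power power_less_one_iff)
  have eq: "qfac a p (n * 2) = qfac a (p ^ 2) n * qfac (a * p) (p ^ 2) n" for n
    by (induction n) (simp_all add: qfac_Suc power_mult [symmetric] mult_ac)
  show "(\<lambda>n. qfac a p (n * 2)) \<longlonglongrightarrow> qpoch_inf a p"
    using LIMSEQ_linear[OF qfac_tendsto[OF assms], of 2] by (simp add: mult.commute)
  show "(\<lambda>n. qfac a p (n * 2)) \<longlonglongrightarrow> qpoch_inf a (p ^ 2) * qpoch_inf (a * p) (p ^ 2)"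
    unfolding eq by (intro tendsto_mult qfac_tendsto p2)
qed

lemma qpoch_inf_dissect3:
  assumes "norm p < 1"
  shows "qpoch_inf a p
    = qpoch_inf a (p ^ 3) * qpoch_inf (a * p) (p ^ 3) * qpoch_inf (a * p ^ 2) (p ^ 3)"
proof (rule LIMSEQ_unique)
  have p3: "norm (p ^ 3) < 1"
    using assms by (simp add: norm_power power_less_one_iff)
  have eq: "qfac a p (n * 3) = qfac a (p ^ 3) n * qfac (a * p) (p ^ 3) n * qfac (a * p ^ 2) (p ^ 3) n" for n
  proof (induction n)
    case (Suc n)
    have "qfac a p (Suc n * 3) = qfac a p (n * 3) * ((1 - a * p ^ (3 * n)) * (1 - a * p * p ^ (3 * n))
        * (1 - a * p ^ 2 * p ^ (3 * n)))"
      using qfac_add[of a p "n * 3" 3]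
      by (simp add: eval_nat_numeral qfac_Suc power_add mult_ac)
    then show ?case
      unfolding Suc power_mult [of p 3 n] by (simp only: qfac_Suc mult_ac)
  qed simp
  show "(\<lambda>n. qfac a p (n * 3)) \<longlonglongrightarrow> qpoch_inf a p"
    using LIMSEQ_linear[OF qfac_tendsto[OF assms], of 3] by (simp add: mult.commute)
  show "(\<lambda>n. qfac a p (n * 3)) \<longlonglongrightarrow>
      qpoch_inf a (p ^ 3) * qpoch_inf (a * p) (p ^ 3) * qpoch_inf (a * p ^ 2) (p ^ 3)"
    unfolding eq by (intro tendsto_mult qfac_tendsto p3)
qed

lemma inverse_qfac_bounded:
  assumes "norm a < 1" "norm p < 1"
  obtains K where "K > 0" "\<And>n. norm (inverse (qfac a p n)) \<le> K"
proof -
  have "(\<lambda>n. inverse (qfac a p n)) \<longlonglongrightarrow> inverse (qpoch_inf a p)"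
    by (intro tendsto_inverse qfac_tendsto qpoch_inf_nonzero assms)
  then have "Bseq (\<lambda>n. inverse (qfac a p n))" by (rule convergent_imp_Bseq[OF convergentI])
  then show ?thesis using that by (auto simp: Bseq_def)
qed

lemma qfac_bounded:
  assumes "norm p < 1"
  obtains K where "K > 0" "\<And>n. norm (qfac a p n) \<le> K"
  using convergent_imp_Bseq[OF convergentI[OF qfac_tendsto[OF assms, of a]]] that
  by (auto simp: Bseq_def)

section \<open>Limits of truncated sums\<close>

text \<open>Dominated convergence for triangular arrays: extended by zero above the diagonal, the
  series converges uniformly in \<open>L\<close> by the Weierstrass M-test, so limit and sum can be
  exchanged.\<close>

lemma tannery:
  fixes f :: "nat \<Rightarrow> nat \<Rightarrow> 'a::banach"
  assumes bound: "\<And>r L. r \<le> L \<Longrightarrow> norm (f r L) \<le> h r"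
    and h: "summable h"
    and lim: "\<And>r. f r \<longlonglongrightarrow> g r"
  shows "(\<lambda>L. \<Sum>r\<le>L. f r L) \<longlonglongrightarrow> (\<Sum>r. g r)"
proof -
  define F where "F r L = (if r \<le> L then f r L else 0)" for r L
  have hpos: "0 \<le> h r" for r using bound[of r r] norm_ge_zero order_trans by blast
  have unif: "uniform_limit UNIV (\<lambda>n L. \<Sum>r<n. F r L) (\<lambda>L. \<Sum>r. F r L) sequentially"
    by (rule Weierstrass_m_test[OF _ h]) (simp add: F_def bound hpos)
  have F: "F r \<longlonglongrightarrow> g r" for r
  proof (rule Lim_transform_eventually[OF lim])
    show "\<forall>\<^sub>F L in sequentially. f r L = F r L"
      unfolding F_def using eventually_ge_at_top[of r] by eventually_elim simp
  qed
  \<comment> \<open>The bound survives the limit in \<open>L\<close>; this gives convergence of the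
    series of \<open>g\<close>.\<close>
  have gb: "norm (g r) \<le> h r" for r
  proof (rule Lim_bounded)
    show "(\<lambda>L. norm (F r L)) \<longlonglongrightarrow> norm (g r)" by (intro tendsto_norm F)
    show "\<forall>L\<ge>0. norm (F r L) \<le> h r" by (simp add: F_def bound hpos)
  qed
  have "(\<lambda>L. \<Sum>r. F r L) \<longlonglongrightarrow> (\<Sum>r. g r)"
  proof (rule swap_uniform_limit'[OF _ _ unif])
    show "\<forall>\<^sub>F n in sequentially. ((\<lambda>L. \<Sum>r<n. F r L) \<longlongrightarrow> (\<Sum>r<n. g r)) sequentially"
      by (intro always_eventually allI tendsto_sum F)
    show "(\<lambda>n. \<Sum>r<n. g r) \<longlonglongrightarrow> (\<Sum>r. g r)"
      by (intro summable_LIMSEQ summable_comparison_test'[OF h, of 0] gb)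
  qed simp_all
  moreover have "(\<Sum>r. F r L) = (\<Sum>r\<le>L. f r L)" for L
    by (subst suminf_finite[of "{..L}"]) (auto simp: F_def intro!: sum.cong)
  ultimately show ?thesis by simp
qed

text \<open>For the \<beta>-side of \<open>bailey_finite\<close>. The dominating series comes from
  the boundedness of the reciprocals of (p; p)_n, which have a finite limit.\<close>

lemma tendsto_sum_over_qfac:
  assumes p: "norm p < 1" and g: "summable (\<lambda>r. norm (g r))"
  shows "(\<lambda>L. \<Sum>r\<le>L. g r / qfac p p (L - r)) \<longlonglongrightarrow> (\<Sum>r. g r) / qpoch_inf p p"
proof -
  obtain K where K: "K > 0" "\<And>n. norm (inverse (qfac p p n)) \<le> K"
    using inverse_qfac_bounded[OF p p] by blast
  have "(\<lambda>L. \<Sum>r\<le>L. g r / qfac p p (L - r)) \<longlonglongrightarrow> (\<Sum>r. g r / qpoch_inf p p)"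
  proof (rule tannery[where h = "\<lambda>r. norm (g r) * K"])
    show "norm (g r / qfac p p (L - r)) \<le> norm (g r) * K" for r L
      using mult_left_mono[OF K(2)[of "L - r"] norm_ge_zero[of "g r"]]
      by (simp add: norm_divide divide_inverse norm_inverse norm_mult)
    show "summable (\<lambda>r. norm (g r) * K)" by (intro summable_mult2 g)
    show "(\<lambda>L. g r / qfac p p (L - r)) \<longlonglongrightarrow> g r / qpoch_inf p p" for r
      by (intro tendsto_divide tendsto_const qpoch_inf_nonzero p
          filterlim_compose[OF qfac_tendsto[OF p]] filterlim_minus_const_nat_at_top)
  qed
  then show ?thesis by (simp add: suminf_divide summable_norm_cancel[OF g])
qed

text \<open>For the \<alpha>-side of \<open>bailey_finite\<close>, and with \<open>e = 1\<close> for
  the finite triple product. The domination is as before, with two reciprocals.\<close>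

lemma tendsto_sum_over_qfac2:
  assumes p: "norm p < 1" and g: "summable (\<lambda>r. norm (g r))"
  shows "(\<lambda>L. \<Sum>r\<le>L. g r / (qfac p p (L - r) * qfac p p (L + r + e)))
    \<longlonglongrightarrow> (\<Sum>r. g r) / (qpoch_inf p p)\<^sup>2"
proof -
  obtain K where K: "K > 0" "\<And>n. norm (inverse (qfac p p n)) \<le> K"
    using inverse_qfac_bounded[OF p p] by blast
  have "(\<lambda>L. \<Sum>r\<le>L. g r / (qfac p p (L - r) * qfac p p (L + r + e)))
    \<longlonglongrightarrow> (\<Sum>r. g r / (qpoch_inf p p * qpoch_inf p p))"
  proof (rule tannery[where h = "\<lambda>r. norm (g r) * (K * K)"])
    show "norm (g r / (qfac p p (L - r) * qfac p p (L + r + e))) \<le> norm (g r) * (K * K)" for r L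
      using mult_left_mono[OF mult_mono[OF K(2)[of "L - r"] K(2)[of "L + r + e"]] norm_ge_zero[of "g r"]] K(1)
      by (simp add: norm_divide divide_inverse norm_inverse norm_mult)
    show "summable (\<lambda>r. norm (g r) * (K * K))" by (intro summable_mult2 g)
    show "(\<lambda>L. g r / (qfac p p (L - r) * qfac p p (L + r + e)))
        \<longlonglongrightarrow> g r / (qpoch_inf p p * qpoch_inf p p)" for r
    proof -
      have "(\<lambda>L. qfac p p (L + r + e)) \<longlonglongrightarrow> qpoch_inf p p"
        using LIMSEQ_ignore_initial_segment[OF qfac_tendsto[OF p], of _ "r + e"]
        by (simp add: add.assoc)
      moreover have "(\<lambda>L. qfac p p (L - r)) \<longlonglongrightarrow> qpoch_inf p p"
        by (intro filterlim_compose[OF qfac_tendsto[OF p]] filterlim_minus_const_nat_at_top)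
      ultimately show ?thesis
        using qpoch_inf_nonzero[OF p p] by (intro tendsto_divide tendsto_mult tendsto_const) auto
    qed
  qed
  then show ?thesis by (simp add: suminf_divide summable_norm_cancel[OF g] power2_eq_square)
qed

section \<open>The \<open>q\<close>-binomial theorem and the \<open>q\<close>-Chu--Vandermonde sum\<close>

text \<open>
  The truncated exponent \<open>n - k\<close> is harmless, since the binomial coefficient next to it vanishes for
  \<open>n < k\<close>.
\<close>

fun qbin :: "complex \<Rightarrow> nat \<Rightarrow> nat \<Rightarrow> complex" where
  "qbin p n 0 = 1"
| "qbin p 0 (Suc k) = 0"
| "qbin p (Suc n) (Suc k) = qbin p n (Suc k) + p ^ (n - k) * qbin p n k"

lemma qbin_eq_0: "n < k \<Longrightarrow> qbin p n k = 0"
  by (induction p n k rule: qbin.induct) auto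

lemma qbin_self: "qbin p n n = 1"
  by (induction n) (simp_all add: qbin_eq_0)

text \<open>The recursion of \<open>qbin\<close> is a q-Pascal rule, so \<open>qbin\<close> is the
  Gaussian binomial coefficient. The division-free form lets the induction on \<open>i + j\<close>
  run without cancellation.\<close>

lemma qbin_mult_qfac: "qbin p (i + j) i * qfac p p i * qfac p p j = qfac p p (i + j)"
proof (induction "i + j" arbitrary: i j)
  case (Suc n)
  consider "i = 0" | i' where "i = Suc i'" "j = 0" | i' j' where "i = Suc i'" "j = Suc j'"
    by (cases i; cases j) auto
  then show ?case
  proof cases
    case 2
    then show ?thesis by (simp add: qbin_self del: qbin.simps)
  next
    case 3
    have IH1: "qbin p (Suc (i' + j')) (Suc i') * qfac p p (Suc i') * qfac p p j' = qfac p p (Suc (i' + j'))"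
      using Suc(1)[of "Suc i'" j'] Suc(2) 3 by simp
    have IH2: "qbin p (Suc (i' + j')) i' * qfac p p i' * qfac p p (Suc j') = qfac p p (Suc (i' + j'))"
      using Suc(1)[of i' "Suc j'"] Suc(2) 3 by simp
    have "qbin p (i + j) i * qfac p p i * qfac p p j
      = (qbin p (Suc (i' + j')) (Suc i') * qfac p p (Suc i') * qfac p p j') * (1 - p * p ^ j')
        + p ^ Suc j' * (1 - p * p ^ i') * (qbin p (Suc (i' + j')) i' * qfac p p i' * qfac p p (Suc j'))"
      unfolding 3 by (simp add: qfac_Suc Suc_diff_le algebra_simps)
    \<comment> \<open>Both instances of the induction hypothesis have the same right-hand side;
      their weights combine by (1 - u) + u (1 - v) = 1 - u v, where u is p to the power
      \<open>Suc j'\<close> and v is p to the power \<open>Suc i'\<close>.\<close>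
    also have "\<dots> = qfac p p (Suc (Suc (i' + j')))"
      unfolding IH1 IH2 by (simp add: qfac_Suc[of _ _ "Suc (i' + j')"] power_add algebra_simps)
    finally show ?thesis using 3 by simp
  qed simp
qed simp

lemma qbin_eq_divide:
  assumes "norm p < 1"
  shows "qbin p (i + j) i = qfac p p (i + j) / (qfac p p i * qfac p p j)"
  using qbin_mult_qfac[of p i j] qfac_nonzero[OF assms assms] by (simp add: field_simps)

lemma Suc_choose_two: "Suc n choose 2 = n + (n choose 2)"
  by (simp add: numeral_2_eq_2)

text \<open>Translates squares in exponents into the binomial exponents of the q-binomial type
  sums.\<close>

lemma square_eq_choose_two: "n ^ 2 = 2 * (n choose 2) + n"
  by (induction n) (simp_all add: Suc_choose_two power2_eq_square)

lemma add_choose_two: "(m + n) choose 2 = (m choose 2) + (n choose 2) + m * n"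
  by (induction n) (simp_all add: Suc_choose_two)

text \<open>The terminating 2phi1 sum with lower parameter c = a b, multiplied by (c; p)_M to clear
  denominators. The q-Pascal rule splits the sum for \<open>Suc M\<close> into multiples of the sums
  for \<open>M\<close> with parameters \<open>a\<close> and \<open>a * p\<close>, hence the
  induction with arbitrary \<open>a\<close>.\<close>

lemma q_chu_vandermonde:
  "(\<Sum>i\<le>M. qbin p M i * qfac a p i * (- b) ^ i * p ^ (i choose 2) * qfac (a * b * p ^ i) p (M - i))
    = qfac b p M"
proof (induction M arbitrary: a)
  case (Suc M)
  define X where "X i = qfac a p i * (- b) ^ i * p ^ (i choose 2) * qfac (a * b * p ^ i) p (Suc M - i)" for i
  have "(\<Sum>i\<le>Suc M. qbin p (Suc M) i * X i) = X 0 + (\<Sum>i\<le>M. qbin p (Suc M) (Suc i) * X (Suc i))"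
    by (subst sum.atMost_Suc_shift) simp
  also have "\<dots> = (X 0 + (\<Sum>i\<le>M. qbin p M (Suc i) * X (Suc i))) + (\<Sum>i\<le>M. p ^ (M - i) * qbin p M i * X (Suc i))"
    by (simp add: algebra_simps sum.distrib)
  also have "X 0 + (\<Sum>i\<le>M. qbin p M (Suc i) * X (Suc i)) = (\<Sum>i\<le>Suc M. qbin p M i * X i)"
    using sum.atMost_Suc_shift[of "\<lambda>i. qbin p M i * X i" M] by simp
  also have "\<dots> = (\<Sum>i\<le>M. qbin p M i * X i)"
    by (simp add: qbin_eq_0)
  also have "\<dots> = (1 - a * b * p ^ M) * (\<Sum>i\<le>M. qbin p M i * qfac a p i * (- b) ^ i * p ^ (i choose 2)
      * qfac (a * b * p ^ i) p (M - i))"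
    unfolding sum_distrib_left
  proof (rule sum.cong)
    fix i assume "i \<in> {..M}"
    then have "qfac (a * b * p ^ i) p (Suc M - i) = qfac (a * b * p ^ i) p (M - i) * (1 - a * b * p ^ M)"
      by (simp add: Suc_diff_le qfac_Suc mult.assoc flip: power_add)
    then show "qbin p M i * X i = (1 - a * b * p ^ M) * (qbin p M i * qfac a p i * (- b) ^ i * p ^ (i choose 2)
      * qfac (a * b * p ^ i) p (M - i))"
      by (simp add: X_def)
  qed simp
  also have "\<dots> = (1 - a * b * p ^ M) * qfac b p M" by (simp add: Suc)
  also have "(\<Sum>i\<le>M. p ^ (M - i) * qbin p M i * X (Suc i))
    = - (b * (1 - a) * p ^ M) * (\<Sum>i\<le>M. qbin p M i * qfac (a * p) p i * (- b) ^ i * p ^ (i choose 2)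
      * qfac ((a * p) * b * p ^ i) p (M - i))"
    unfolding sum_distrib_left
  proof (rule sum.cong)
    fix i assume "i \<in> {..M}"
    then have "p ^ M = p ^ (M - i) * p ^ i" by (simp flip: power_add)
    then show "p ^ (M - i) * qbin p M i * X (Suc i)
      = - (b * (1 - a) * p ^ M) * (qbin p M i * qfac (a * p) p i * (- b) ^ i * p ^ (i choose 2)
      * qfac ((a * p) * b * p ^ i) p (M - i))"
      by (simp add: X_def qfac_Suc_shift Suc_choose_two power_add mult_ac)
  qed simp
  also have "\<dots> = - (b * (1 - a) * p ^ M) * qfac b p M" unfolding Suc ..
  also have "(1 - a * b * p ^ M) * qfac b p M + - (b * (1 - a) * p ^ M) * qfac b p M = qfac b p (Suc M)"
    by (simp add: qfac_Suc algebra_simps)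
  finally show ?case by (simp add: X_def mult.assoc)
qed (simp add: numeral_2_eq_2)

lemma q_binomial:
  "(\<Sum>i\<le>M. qbin p M i * (- b) ^ i * p ^ (i choose 2)) = qfac b p M"
proof -
  have "qfac 0 p n = 1" for n by (simp add: qfac_def)
  then show ?thesis using q_chu_vandermonde[of p M 0 b] by simp
qed

section \<open>Bailey's lemma\<close>

lemma norm_power2_less_one: "norm (q :: complex) < 1 \<Longrightarrow> norm (q\<^sup>2) < 1"
  by (simp add: norm_power power_less_one_iff)

text \<open>
  The cases \<open>e = 0\<close> and \<open>e = 1\<close> are Bailey's lemma relative to \<open>1\<close> and \<open>q\<^sup>2\<close>; the factor \<open>1 - q\<^sup>2\<close> that
  separates \<open>(q\<^sup>4; q\<^sup>2)\<^sub>n\<close> from \<open>(q\<^sup>2; q\<^sup>2)\<^sub>n\<^sub>+\<^sub>1\<close> is absorbed into \<open>\<alpha>\<close>.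
\<close>

lemma bailey_kernel:
  assumes q: "norm q < 1" and "r \<le> L"
  shows "(\<Sum>j=r..L. qfac (- q) (q\<^sup>2) j * q ^ (j\<^sup>2 + 2 * e * j)
        / (qfac (q\<^sup>2) (q\<^sup>2) (L - j) * (qfac (q\<^sup>2) (q\<^sup>2) (j - r) * qfac (q\<^sup>2) (q\<^sup>2) (j + r + e))))
    = qfac (- q) (q\<^sup>2) r * qfac (- (q ^ (2 * r + 1 + 2 * e))) (q\<^sup>2) (L - r) * q ^ (r\<^sup>2 + 2 * e * r)
        / (qfac (q\<^sup>2) (q\<^sup>2) (L - r) * qfac (q\<^sup>2) (q\<^sup>2) (L + r + e))"
    (is "(\<Sum>j=r..L. ?f j) = ?rhs")
proof -
  define p where "p = q\<^sup>2"
  have p: "norm p < 1" unfolding p_def using q by (rule norm_power2_less_one)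
  obtain M where L: "L = M + r" using \<open>r \<le> L\<close> by (metis le_add_diff_inverse2)
  \<comment> \<open>After the shift \<open>j = i + r\<close>, \<open>a\<close> comes from splitting
    (-q; q^2)_j, \<open>b\<close> from the part of the exponent of \<open>q\<close> linear in
    \<open>i\<close>, and \<open>a * b\<close> is the parameter left when (p; p) with index
    \<open>2 * r + e\<close> is split off. These fit together as a q-Chu-Vandermonde sum.\<close>
  define a b where "a = - (q ^ (2 * r + 1))" and "b = - (q ^ (2 * r + 1 + 2 * e))"
  have ab: "a * b = p * p ^ (2 * r + e)"
    unfolding a_def b_def p_def
    by (simp only: mult_minus_left mult_minus_right minus_minus flip: power_add power_mult power_Suc)
       (simp add: algebra_simps)
  have split: "qfac p p (2 * r + e + k) = qfac p p (2 * r + e) * qfac (a * b) p k" for k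
    by (simp add: qfac_add ab)
  note nz = qfac_nonzero[OF p p]
  have abnz: "qfac (a * b) p k \<noteq> 0" for k
    using split[of k] nz[of "2 * r + e + k"] by auto
  \<comment> \<open>Everything independent of \<open>i\<close>, normalized so that the remaining sum
    is literally the one of \<open>q_chu_vandermonde\<close>.\<close>
  define C where "C = qfac (- q) p r * q ^ (r\<^sup>2 + 2 * e * r) / (qfac p p M * qfac p p (2 * r + e) * qfac (a * b) p M)"
  have cancel: "x1 * x2 * (x3 * (x4 * x5)) / (y1 * (y2 * (y3 * y4)))
      = x1 * x3 / (z1 * y3 * (y4 * z2)) * (z1 / (y2 * y1) * x2 * x4 * x5 * z2)"
    if "z1 \<noteq> 0" "z2 \<noteq> 0" for x1 x2 x3 x4 x5 y1 y2 y3 y4 z1 z2 :: complex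
    using that by (simp add: field_simps)
  have summand: "?f (i + r) = C * (qbin p M i * qfac a p i * (- b) ^ i * p ^ (i choose 2)
      * qfac (a * b * p ^ i) p (M - i))" if "i \<le> M" for i
  proof -
    have e1: "qfac (- q) p (i + r) = qfac (- q) p r * qfac a p i"
      by (subst add.commute) (simp add: qfac_add a_def p_def power_mult)
    have "(i + r)\<^sup>2 + 2 * e * (i + r) = (r\<^sup>2 + 2 * e * r) + ((2 * r + 1 + 2 * e) * i + 2 * (i choose 2))"
      using square_eq_choose_two[of i] by (simp add: power2_eq_square algebra_simps)
    then have e2: "q ^ ((i + r)\<^sup>2 + 2 * e * (i + r)) = q ^ (r\<^sup>2 + 2 * e * r) * ((- b) ^ i * p ^ (i choose 2))"
      by (simp only: power_add power_mult b_def p_def minus_minus)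
    have e3: "qbin p M i = qfac p p M / (qfac p p i * qfac p p (M - i))"
      using qbin_eq_divide[OF p, of i "M - i"] that by simp
    have e4: "qfac p p (i + r + r + e) = qfac p p (2 * r + e) * qfac (a * b) p i"
      using split[of i] by (simp add: algebra_simps mult_2 mult_2_right)
    have e5: "qfac (a * b) p M = qfac (a * b) p i * qfac (a * b * p ^ i) p (M - i)"
      using qfac_add[of "a * b" p i "M - i"] that by simp
    have nz5: "qfac (a * b * p ^ i) p (M - i) \<noteq> 0"
      using e5 abnz[of M] by auto
    have "?f (i + r) = qfac (- q) p r * qfac a p i * (q ^ (r\<^sup>2 + 2 * e * r) * ((- b) ^ i * p ^ (i choose 2)))
        / (qfac p p (M - i) * (qfac p p i * (qfac p p (2 * r + e) * qfac (a * b) p i)))"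
      unfolding p_def [symmetric] e1 e2 e4 using that by (simp add: L)
    also have "\<dots> = C * (qbin p M i * qfac a p i * (- b) ^ i * p ^ (i choose 2)
      * qfac (a * b * p ^ i) p (M - i))"
      unfolding C_def e3 e5 by (rule cancel[OF nz nz5])
    finally show ?thesis .
  qed
  have "(\<Sum>j=r..L. ?f j) = (\<Sum>i\<le>M. ?f (i + r))"
    unfolding L using sum.shift_bounds_cl_nat_ivl[of ?f 0 r M] by (simp add: L atLeast0AtMost)
  also have "\<dots> = C * qfac b p M"
    unfolding q_chu_vandermonde[of p M a b, symmetric] sum_distrib_left
    by (intro sum.cong refl summand) simp
  also have "\<dots> = ?rhs"
    unfolding C_def L p_def [symmetric] b_def [symmetric]
    using split[of M] abnz[of M] nz[of "2 * r + e"] by (simp add: algebra_simps mult_2_right)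
  finally show ?thesis .
qed

text \<open>Insert the defining relation of the pair for \<open>\<beta>\<close>, exchange the two
  triangular sums, and evaluate the inner sum by \<open>bailey_kernel\<close>.\<close>

lemma bailey_finite:
  assumes q: "norm q < 1"
    and pair: "\<And>n. (\<Sum>r\<le>n. \<alpha> r / (qfac (q\<^sup>2) (q\<^sup>2) (n - r) * qfac (q\<^sup>2) (q\<^sup>2) (n + r + e))) = \<beta> n"
  shows "(\<Sum>j\<le>L. qfac (- q) (q\<^sup>2) j * q ^ (j\<^sup>2 + 2 * e * j) * \<beta> j / qfac (q\<^sup>2) (q\<^sup>2) (L - j))
    = (\<Sum>r\<le>L. \<alpha> r * (qfac (- q) (q\<^sup>2) r * qfac (- (q ^ (2 * r + 1 + 2 * e))) (q\<^sup>2) (L - r) * q ^ (r\<^sup>2 + 2 * e * r))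
        / (qfac (q\<^sup>2) (q\<^sup>2) (L - r) * qfac (q\<^sup>2) (q\<^sup>2) (L + r + e)))"
proof -
  define w where "w j = qfac (- q) (q\<^sup>2) j * q ^ (j\<^sup>2 + 2 * e * j)" for j
  define P where "P = qfac (q\<^sup>2) (q\<^sup>2)"
  have "(\<Sum>j\<le>L. w j * \<beta> j / P (L - j))
      = (\<Sum>j\<in>{..L}. \<Sum>r | r \<in> {..L} \<and> r \<le> j. \<alpha> r * (w j / (P (L - j) * (P (j - r) * P (j + r + e)))))"
    unfolding pair [symmetric] P_def [symmetric] sum_distrib_left sum_divide_distrib
    by (intro sum.cong) (auto simp: mult_ac)
  also have "\<dots> = (\<Sum>r\<in>{..L}. \<Sum>j | j \<in> {..L} \<and> r \<le> j. \<alpha> r * (w j / (P (L - j) * (P (j - r) * P (j + r + e)))))"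
    by (rule sum.swap_restrict) auto
  also have "\<dots> = (\<Sum>r\<le>L. \<alpha> r * (\<Sum>j=r..L. w j / (P (L - j) * (P (j - r) * P (j + r + e)))))"
    unfolding sum_distrib_left by (intro sum.cong) auto
  also have "\<dots> = (\<Sum>r\<le>L. \<alpha> r * (qfac (- q) (q\<^sup>2) r * qfac (- (q ^ (2 * r + 1 + 2 * e))) (q\<^sup>2) (L - r) * q ^ (r\<^sup>2 + 2 * e * r))
        / (P (L - r) * P (L + r + e)))"
    unfolding w_def P_def by (intro sum.cong refl) (simp add: bailey_kernel[OF q])
  finally show ?thesis unfolding w_def P_def .
qed

section \<open>Two Bailey pairs with a common \<beta>-part\<close>

text \<open>The partial sums of the difference between the statements for \<open>n\<close> and \<open>n + 1\<close> telescope.\<close>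

lemma bailey_pair_even:
  assumes p: "norm p < 1"
  shows "(\<Sum>r\<le>n. (if r = 0 then 1 else 2 * (- 1) ^ r * p ^ r\<^sup>2) / (qfac p p (n - r) * qfac p p (n + r)))
    = 1 / qfac (p\<^sup>2) (p\<^sup>2) n"
proof (induction n)
  case (Suc n)
  define I where "I k = inverse (qfac p p k)" for k
  define \<alpha> where "\<alpha> r = (if r = 0 then 1 else 2 * (- 1) ^ r * p ^ r\<^sup>2)" for r :: nat
  define m where "m = Suc n"
  have I: "I k = (1 - p * p ^ k) * I (Suc k)" for k
    unfolding I_def by (rule inverse_qfac_Suc[OF p])
  \<comment> \<open>The bracket is (1 - x y) - (1 - x) (1 - y) with x, y the powers of p with
    exponents \<open>m - r\<close>, \<open>m + r\<close>: what remains when the level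
    \<open>n\<close> term is subtracted from 1 - p^(2m) times the level \<open>m\<close> term. The
    last power factor makes the right-hand side vanish at \<open>R = m\<close>.\<close>
  have tele: "(\<Sum>r\<le>R. \<alpha> r * (I (m - r) * I (m + r)) * (p ^ (m - r) + p ^ (m + r) - 2 * p ^ (2 * m)))
    = 2 * p ^ m * (- 1) ^ R * p ^ (R\<^sup>2 + R) * (1 - p ^ (m - R)) * (I (m - R) * I (m + R))" if "R \<le> m" for R
    using that
  proof (induction R)
    case 0
    then show ?case by (simp add: \<alpha>_def algebra_simps mult_2_right power_add)
  next
    case (Suc R)
    then obtain d where d: "m = d + Suc R" by (metis le_add_diff_inverse2)
    have "I (Suc d) * (1 - p ^ Suc d) = I d" using I[of d] by simp
    moreover have "I (m + R) = (1 - p ^ Suc (m + R)) * I (m + Suc R)" using I[of "m + R"] by simp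
    ultimately have step: "2 * p ^ m * (- 1) ^ R * p ^ (R\<^sup>2 + R) * (1 - p ^ (m - R)) * (I (m - R) * I (m + R))
      = 2 * p ^ m * (- 1) ^ R * p ^ (R\<^sup>2 + R) * (1 - p ^ Suc (m + R)) * (I d * I (m + Suc R))"
      by (simp add: d mult_ac)
    \<comment> \<open>Over these powers the induction step becomes a polynomial identity.\<close>
    define x y z where "x = p ^ d" and "y = p ^ R" and "z = p ^ R\<^sup>2"
    have e: "p ^ m = p * x * y" "p ^ (R\<^sup>2 + R) = z * y" "p ^ (m + Suc R) = p ^ 2 * x * y ^ 2"
      "p ^ Suc (m + R) = p ^ 2 * x * y ^ 2" "p ^ (2 * m) = p ^ 2 * x ^ 2 * y ^ 2"
      "p ^ (Suc R)\<^sup>2 = p * z * y ^ 2" "p ^ ((Suc R)\<^sup>2 + Suc R) = p ^ 2 * z * y ^ 3"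
      "p ^ d = x" "m - Suc R = d"
      by (simp_all add: d x_def y_def z_def power_add power2_eq_square power3_eq_cube mult_2 mult_2_right mult_ac)
    have \<alpha>_Suc: "\<alpha> (Suc R) = - 2 * (- 1) ^ R * p ^ (Suc R)\<^sup>2" by (simp add: \<alpha>_def)
    have poly: "2 * (p * x * y) * s * (z * y) * (1 - p ^ 2 * x * y ^ 2) * J
        + - 2 * s * (p * z * y ^ 2) * J * (x + p ^ 2 * x * y ^ 2 - 2 * (p ^ 2 * x ^ 2 * y ^ 2))
      = 2 * (p * x * y) * (- 1 * s) * (p ^ 2 * z * y ^ 3) * (1 - x) * J" for s J
      by algebra
    have "(\<Sum>r\<le>R. \<alpha> r * (I (m - r) * I (m + r)) * (p ^ (m - r) + p ^ (m + r) - 2 * p ^ (2 * m)))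
      = 2 * p ^ m * (- 1) ^ R * p ^ (R\<^sup>2 + R) * (1 - p ^ Suc (m + R)) * (I d * I (m + Suc R))"
      using Suc.IH Suc.prems step by simp
    then show ?case
      unfolding sum.atMost_Suc \<alpha>_Suc e power_Suc[of "- 1"] by (simp only: poly)
  qed
  have eq: "\<alpha> r * (I (m - r) * I (m + r)) * (1 - p ^ (2 * m))
    = \<alpha> r * (I (m - r) * I (m + r)) * (p ^ (m - r) + p ^ (m + r) - 2 * p ^ (2 * m))
      + (if r \<le> n then \<alpha> r * (I (n - r) * I (n + r)) else 0)" if "r \<le> m" for r
  proof (cases "r \<le> n")
    case True
    have 1: "I (n - r) = (1 - p ^ (m - r)) * I (m - r)" "I (n + r) = (1 - p ^ (m + r)) * I (m + r)"
      using I[of "n - r"] I[of "n + r"] True by (simp_all add: m_def Suc_diff_le)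
    have 2: "p ^ (2 * m) = p ^ (m - r) * p ^ (m + r)" using that by (simp add: mult_2 flip: power_add)
    show ?thesis using True unfolding 1 2 by (simp add: algebra_simps)
  next
    case False
    \<comment> \<open>The top term has no counterpart at level \<open>n\<close>; the bracket alone
      already equals 1 - p^(2m).\<close>
    then have "r = m" using that by (simp add: m_def)
    moreover have "p ^ 0 + w - 2 * w = 1 - w" for w :: complex by simp
    ultimately show ?thesis using False by (simp only: mult_2[of m] diff_self_eq_0 if_False add_0_right)
  qed
  have "(\<Sum>r\<le>m. \<alpha> r * (I (m - r) * I (m + r))) * (1 - p ^ (2 * m))
    = (\<Sum>r\<le>m. \<alpha> r * (I (m - r) * I (m + r)) * (p ^ (m - r) + p ^ (m + r) - 2 * p ^ (2 * m)))
      + (\<Sum>r\<le>n. \<alpha> r * (I (n - r) * I (n + r)))"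
  proof -
    have "(\<Sum>r\<le>m. if r \<le> n then \<alpha> r * (I (n - r) * I (n + r)) else 0) = (\<Sum>r\<le>n. \<alpha> r * (I (n - r) * I (n + r)))"
      unfolding m_def by (rule sum.mono_neutral_cong_right) auto
    then show ?thesis
      unfolding sum_distrib_right by (subst sum.cong[OF refl eq]) (simp_all only: sum.distrib atMost_iff)
  qed
  also have "(\<Sum>r\<le>m. \<alpha> r * (I (m - r) * I (m + r)) * (p ^ (m - r) + p ^ (m + r) - 2 * p ^ (2 * m))) = 0"
    by (simp add: tele)
  also have "(\<Sum>r\<le>n. \<alpha> r * (I (n - r) * I (n + r))) = 1 / qfac (p\<^sup>2) (p\<^sup>2) n"
    using Suc by (simp add: \<alpha>_def I_def divide_inverse)
  also have "p ^ (2 * m) = p\<^sup>2 * (p\<^sup>2) ^ n"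
    unfolding power_mult by (simp add: m_def)
  finally have "(\<Sum>r\<le>m. \<alpha> r * (I (m - r) * I (m + r))) * (1 - p\<^sup>2 * (p\<^sup>2) ^ n) = 1 / qfac (p\<^sup>2) (p\<^sup>2) n"
    by simp
  moreover have "1 - p\<^sup>2 * (p\<^sup>2) ^ n \<noteq> 0"
    using qfac_nonzero[OF norm_power2_less_one[OF p] norm_power2_less_one[OF p], of "Suc n"] by (simp add: qfac_Suc)
  ultimately have "(\<Sum>r\<le>m. \<alpha> r * (I (m - r) * I (m + r))) = 1 / qfac (p\<^sup>2) (p\<^sup>2) m"
    unfolding m_def qfac_Suc divide_divide_eq_left [symmetric] by (simp only: eq_divide_eq if_True not_False_eq_True)
  then show ?case by (simp add: \<alpha>_def I_def m_def divide_inverse)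
qed simp

text \<open>Reduced to the even pair at \<open>m = Suc n\<close>: its sum times 1 - p^(2m) equals
  the odd sum at \<open>n\<close>, and the same factor turns the reciprocal of (p^2; p^2)_m into
  that of (p^2; p^2)_n.\<close>

lemma bailey_pair_odd:
  assumes p: "norm p < 1"
  shows "(\<Sum>r\<le>n. (- 1) ^ r * p ^ r\<^sup>2 * (1 - p ^ (2 * r + 1)) / (qfac p p (n - r) * qfac p p (n + r + 1)))
    = 1 / qfac (p\<^sup>2) (p\<^sup>2) n"
proof -
  define I where "I k = inverse (qfac p p k)" for k
  define \<alpha> where "\<alpha> r = (if r = 0 then 1 else 2 * (- 1) ^ r * p ^ r\<^sup>2)" for r :: nat
  define m where "m = Suc n"
  have I: "I k = (1 - p * p ^ k) * I (Suc k)" for k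
    unfolding I_def by (rule inverse_qfac_Suc[OF p])
  \<comment> \<open>The odd sum lags one index behind the even one, hence \<open>r<R\<close>. At
    \<open>R = m\<close> the boundary term vanishes and the odd sum is complete.\<close>
  have tele: "(\<Sum>r\<le>R. \<alpha> r * (I (m - r) * I (m + r))) * (1 - p ^ (2 * m))
    = (\<Sum>r<R. (- 1) ^ r * p ^ r\<^sup>2 * (1 - p ^ (2 * r + 1)) * (I (n - r) * I (n + r + 1)))
      + (- 1) ^ R * p ^ R\<^sup>2 * (1 - p ^ (m - R)) * (1 + p ^ (m + R)) * (I (m - R) * I (m + R))"
    if "R \<le> m" for R
    using that
  proof (induction R)
    case 0
    then show ?case by (simp add: \<alpha>_def algebra_simps mult_2_right power_add)
  next
    case (Suc R)
    then obtain d where d: "m = d + Suc R" by (metis le_add_diff_inverse2)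
    then have n: "n = d + R" by (simp add: m_def)
    have "I (Suc d) * (1 - p ^ Suc d) = I d" using I[of d] by simp
    moreover have "I (m + R) = (1 - p ^ Suc (m + R)) * I (m + Suc R)" using I[of "m + R"] by simp
    ultimately have step: "(- 1) ^ R * p ^ R\<^sup>2 * (1 - p ^ (m - R)) * (1 + p ^ (m + R)) * (I (m - R) * I (m + R))
      = (- 1) ^ R * p ^ R\<^sup>2 * (1 + p ^ (m + R)) * (1 - p ^ Suc (m + R)) * (I d * I (m + Suc R))"
      by (simp add: d mult_ac)
    have InR: "I (n + R + 1) = (1 - p ^ Suc (m + R)) * I (m + Suc R)"
      using I[of "m + R"] by (simp add: m_def)
    have Id: "I (n - R) = I d" by (simp add: n)
    define x y z where "x = p ^ d" and "y = p ^ R" and "z = p ^ R\<^sup>2"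
    have e: "p ^ m = p * x * y" "p ^ (2 * R + 1) = p * y ^ 2" "p ^ (m + Suc R) = p ^ 2 * x * y ^ 2"
      "p ^ (m + R) = p * x * y ^ 2"
      "p ^ Suc (m + R) = p ^ 2 * x * y ^ 2" "p ^ (2 * m) = p ^ 2 * x ^ 2 * y ^ 2"
      "p ^ (Suc R)\<^sup>2 = p * z * y ^ 2"
      "p ^ d = x" "m - Suc R = d" "p ^ R\<^sup>2 = z"
      by (simp_all add: d x_def y_def z_def power_add power2_eq_square power3_eq_cube mult_2 mult_2_right mult_ac)
    have \<alpha>_Suc: "\<alpha> (Suc R) = - 2 * (- 1) ^ R * p ^ (Suc R)\<^sup>2" by (simp add: \<alpha>_def)
    have poly: "t + s * z * (1 + p * x * y ^ 2) * (1 - p ^ 2 * x * y ^ 2) * (J * K)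
        + - 2 * s * (p * z * y ^ 2) * (J * K) * (1 - p ^ 2 * x ^ 2 * y ^ 2)
      = t + s * z * (1 - p * y ^ 2) * (J * ((1 - p ^ 2 * x * y ^ 2) * K))
        + - 1 * s * (p * z * y ^ 2) * (1 - x) * (1 + p ^ 2 * x * y ^ 2) * (J * K)" for s t J K
      by algebra
    have "(\<Sum>r\<le>R. \<alpha> r * (I (m - r) * I (m + r))) * (1 - p ^ (2 * m))
      = (\<Sum>r<R. (- 1) ^ r * p ^ r\<^sup>2 * (1 - p ^ (2 * r + 1)) * (I (n - r) * I (n + r + 1)))
        + (- 1) ^ R * p ^ R\<^sup>2 * (1 + p ^ (m + R)) * (1 - p ^ Suc (m + R)) * (I d * I (m + Suc R))"
      using Suc.IH Suc.prems step by simp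
    then show ?case
      unfolding sum.atMost_Suc sum.lessThan_Suc distrib_right[of _ _ "1 - p ^ (2 * m)"]
      unfolding \<alpha>_Suc InR Id e power_Suc[of "- 1"] by (simp only: poly)
  qed
  have "(\<Sum>r\<le>n. (- 1) ^ r * p ^ r\<^sup>2 * (1 - p ^ (2 * r + 1)) * (I (n - r) * I (n + r + 1)))
    = (\<Sum>r\<le>m. \<alpha> r * (I (m - r) * I (m + r))) * (1 - p ^ (2 * m))"
    using tele[of m] by (simp add: m_def lessThan_Suc_atMost)
  also have "(\<Sum>r\<le>m. \<alpha> r * (I (m - r) * I (m + r))) = 1 / qfac (p\<^sup>2) (p\<^sup>2) m"
    using bailey_pair_even[OF p, of m] by (simp add: \<alpha>_def I_def divide_inverse)
  also have "p ^ (2 * m) = p\<^sup>2 * (p\<^sup>2) ^ n"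
    unfolding power_mult by (simp add: m_def)
  also have "1 / qfac (p\<^sup>2) (p\<^sup>2) m * (1 - p\<^sup>2 * (p\<^sup>2) ^ n) = 1 / qfac (p\<^sup>2) (p\<^sup>2) n"
    using qfac_nonzero[OF norm_power2_less_one[OF p] norm_power2_less_one[OF p], of "Suc n"]
    by (simp add: m_def qfac_Suc)
  finally show ?thesis by (simp add: I_def divide_inverse)
qed

text \<open>The assumption on \<open>g\<close> asks that the weighted \<open>\<alpha>\<close>
  separates into a factor depending on \<open>L\<close> only and one depending on \<open>r\<close>
  only. Both sides of \<open>bailey_finite\<close> then have limits, and comparing them cancels one
  factor (q^2; q^2)_inf.\<close>

lemma bailey_limit:
  fixes \<alpha> \<beta> g :: "nat \<Rightarrow> complex"
  assumes q: "norm q < 1"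
    and pair: "\<And>n. (\<Sum>r\<le>n. \<alpha> r / (qfac (q\<^sup>2) (q\<^sup>2) (n - r) * qfac (q\<^sup>2) (q\<^sup>2) (n + r + e))) = \<beta> n"
    and g: "\<And>r L. r \<le> L \<Longrightarrow>
      \<alpha> r * (qfac (- q) (q\<^sup>2) r * qfac (- (q ^ (2 * r + 1 + 2 * e))) (q\<^sup>2) (L - r) * q ^ (r\<^sup>2 + 2 * e * r))
        = qfac (- q) (q\<^sup>2) (L + e) * g r"
    and summable_g: "summable (\<lambda>r. norm (g r))"
    and summable_\<beta>: "summable (\<lambda>j. norm (qfac (- q) (q\<^sup>2) j * q ^ (j\<^sup>2 + 2 * e * j) * \<beta> j))"
  shows "(\<Sum>j. qfac (- q) (q\<^sup>2) j * q ^ (j\<^sup>2 + 2 * e * j) * \<beta> j)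
    = qpoch_inf (- q) (q\<^sup>2) / qpoch_inf (q\<^sup>2) (q\<^sup>2) * (\<Sum>r. g r)"
    (is "?S = _")
proof -
  define p where "p = q\<^sup>2"
  have p: "norm p < 1" unfolding p_def using q by (rule norm_power2_less_one)
  have "(\<lambda>L. \<Sum>j\<le>L. qfac (- q) (q\<^sup>2) j * q ^ (j\<^sup>2 + 2 * e * j) * \<beta> j / qfac p p (L - j))
      \<longlonglongrightarrow> ?S / qpoch_inf p p"
    by (rule tendsto_sum_over_qfac[OF p summable_\<beta>])
  moreover have "(\<Sum>j\<le>L. qfac (- q) (q\<^sup>2) j * q ^ (j\<^sup>2 + 2 * e * j) * \<beta> j / qfac p p (L - j))
      = qfac (- q) p (L + e) * (\<Sum>r\<le>L. g r / (qfac p p (L - r) * qfac p p (L + r + e)))" for L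
    unfolding p_def bailey_finite[OF q pair] sum_distrib_left
    by (intro sum.cong refl) (simp only: atMost_iff g times_divide_eq_right)
  moreover have "(\<lambda>L. qfac (- q) p (L + e) * (\<Sum>r\<le>L. g r / (qfac p p (L - r) * qfac p p (L + r + e))))
      \<longlonglongrightarrow> qpoch_inf (- q) p * ((\<Sum>r. g r) / (qpoch_inf p p)\<^sup>2)"
    by (intro tendsto_mult tendsto_sum_over_qfac2 LIMSEQ_ignore_initial_segment qfac_tendsto p summable_g)
  ultimately have "?S / qpoch_inf p p = qpoch_inf (- q) p * ((\<Sum>r. g r) / (qpoch_inf p p)\<^sup>2)"
    using LIMSEQ_unique by auto
  then show ?thesis
    using qpoch_inf_nonzero[OF p p] by (simp add: p_def field_simps power2_eq_square)
qed

section \<open>The Jacobi triple product\<close>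

text \<open>Since \<open>a * b = p\<close>, each factor satisfies - a p^k (1 - b / p^(k+1)) = 1 - a
  p^k; the prefactor collects these multipliers.\<close>

lemma qfac_reverse:
  assumes "a * b = p" "p \<noteq> 0"
  shows "(- a) ^ n * p ^ (n choose 2) * qfac (b / p ^ n) p n = qfac a p n"
proof (induction n)
  case (Suc n)
  have "qfac (b / p ^ Suc n) p (Suc n) = (1 - b / p ^ Suc n) * qfac (b / p ^ n) p n"
    using assms by (simp add: qfac_Suc_shift)
  then have "(- a) ^ Suc n * p ^ (Suc n choose 2) * qfac (b / p ^ Suc n) p (Suc n)
    = (- a * p ^ n * (1 - b / p ^ Suc n)) * ((- a) ^ n * p ^ (n choose 2) * qfac (b / p ^ n) p n)"
    by (simp add: Suc_choose_two power_add)
  also have "- a * p ^ n * (1 - b / p ^ Suc n) = 1 - a * p ^ n"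
    using assms by (simp add: field_simps)
  finally show ?case unfolding Suc qfac_Suc[of a p n] by (simp only: mult.commute)
qed (simp add: numeral_2_eq_2)

text \<open>
  The two terms of the bilateral series with indices \<open>r\<close> and \<open>- r - 1\<close> are combined, so that only
  natural exponents occur.
\<close>

lemma jacobi_triple_finite:
  assumes p: "norm p < 1" "p \<noteq> 0" and ab: "a * b = p"
  shows "(\<Sum>r\<le>n. (- 1) ^ r * p ^ (r choose 2) * a ^ r * (1 - b ^ (2 * r + 1))
        / (qfac p p (n - r) * qfac p p (n + r + 1)))
    = qfac a p n * qfac b p (Suc n) / qfac p p (2 * n + 1)"
proof -
  \<comment> \<open>The q-binomial theorem is applied to (c; p) of length 2n+1, which splits into
    (c; p)_n and (b; p)_(n+1); multiplication by \<open>F\<close> reverses the first into (a;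
    p)_n.\<close>
  define c where "c = b / p ^ n"
  define F where "F = (- a) ^ n * p ^ (n choose 2)"
  define T where "T k = qbin p (2 * n + 1) k * (- c) ^ k * p ^ (k choose 2)" for k
  define Q where "Q = qfac p p (2 * n + 1)"
  have ac: "(- a) ^ k * (- c) ^ k = p ^ k / p ^ (n * k)" for k
    by (simp add: c_def ab power_divide power_mult flip: power_mult_distrib)
  \<comment> \<open>The summation range is cut after \<open>n\<close> and indexed outwards from the
    cut: \<open>n - r\<close> gives the bilateral index \<open>r\<close>, and
    \<open>r + Suc n\<close> gives \<open>- r - 1\<close>.\<close>
  have low: "F * T (n - r) = Q * ((- 1) ^ r * p ^ (r choose 2) * a ^ r / (qfac p p (n - r) * qfac p p (n + r + 1)))"
    if "r \<le> n" for r
  proof -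
    from le_Suc_ex[OF that] obtain d where n: "n = r + d" by blast
    have "(n choose 2) + (d choose 2) + d = (r choose 2) + n * d"
      using square_eq_choose_two[of d] by (simp add: n add_choose_two power2_eq_square algebra_simps)
    then have "p ^ (n choose 2) * p ^ (d choose 2) * p ^ d = p ^ (r choose 2) * p ^ (n * d)"
      by (simp flip: power_add)
    then have e: "p ^ (n choose 2) * p ^ (d choose 2) * (p ^ d / p ^ (n * d)) = p ^ (r choose 2)"
      using p by (simp add: field_simps)
    have "F * T d = qbin p (2 * n + 1) d * (- a) ^ r * (p ^ (n choose 2) * p ^ (d choose 2) * ((- a) ^ d * (- c) ^ d))"
      unfolding F_def T_def by (subst (1) n) (simp only: power_add mult_ac)
    also have "\<dots> = qbin p (2 * n + 1) d * (- a) ^ r * p ^ (r choose 2)"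
      unfolding ac e ..
    also have "qbin p (2 * n + 1) d = Q / (qfac p p d * qfac p p (n + r + 1))"
      using qbin_eq_divide[OF p(1), of d "n + r + 1"] by (simp add: n Q_def algebra_simps mult_2_right)
    finally show ?thesis using n by (simp add: power_minus[of a])
  qed
  have high: "F * T (r + Suc n) = - (Q * ((- 1) ^ r * p ^ (r choose 2) * a ^ r * b ^ (2 * r + 1)
      / (qfac p p (n - r) * qfac p p (n + r + 1))))" if "r \<le> n" for r
  proof -
    have "(n choose 2) + (r + Suc n choose 2) + n = (r choose 2) + r + (n * n + n * Suc r)"
      using square_eq_choose_two[of n] add_choose_two[of n "Suc r"]
      by (simp add: Suc_choose_two power2_eq_square algebra_simps)
    then have "p ^ (n choose 2) * p ^ (r + Suc n choose 2) * p ^ n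
        = p ^ (r choose 2) * p ^ r * (p ^ (n * n) * p ^ (n * Suc r))"
      by (simp only: flip: power_add)
    then have e: "p ^ (n choose 2) * p ^ (r + Suc n choose 2) * (p ^ n / p ^ (n * n)) = p ^ (r choose 2) * p ^ r * p ^ (n * Suc r)"
      using p by (simp add: field_simps)
    have "F * T (r + Suc n) = qbin p (2 * n + 1) (r + Suc n) * (- c) ^ Suc r
        * (p ^ (n choose 2) * p ^ (r + Suc n choose 2) * ((- a) ^ n * (- c) ^ n))"
      unfolding F_def T_def by (simp add: power_add)
    also have "\<dots> = qbin p (2 * n + 1) (r + Suc n) * ((- c) ^ Suc r * p ^ (n * Suc r)) * (p ^ (r choose 2) * p ^ r)"
      unfolding ac e by simp
    also have "(- c) ^ Suc r * p ^ (n * Suc r) = (- b) ^ Suc r"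
      unfolding power_mult using p by (simp only: c_def flip: power_mult_distrib) simp
    also have "p ^ r = a ^ r * b ^ r" by (simp add: ab [symmetric] power_mult_distrib)
    also have "qbin p (2 * n + 1) (r + Suc n) = Q / (qfac p p (n - r) * qfac p p (n + r + 1))"
      using qbin_eq_divide[OF p(1), of "n + r + 1" "n - r"] that by (simp add: Q_def algebra_simps mult_2_right)
    finally show ?thesis
      by (simp add: power_minus[of b] power_add mult_2_right mult_ac)
  qed
  have factor_out: "Q * (x / y) + - (Q * (x * z / y)) = Q * (x * (1 - z) / y)" for x y z
    by (simp add: right_diff_distrib diff_divide_distrib)
  have "qfac a p n * qfac b p (Suc n) = F * qfac c p (2 * n + 1)"
    using qfac_reverse[OF ab p(2), of n] qfac_add[of c p n "Suc n"] p(2)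
    by (simp add: F_def c_def mult_2 mult.assoc)
  also have "\<dots> = F * (\<Sum>k\<le>2 * n + 1. T k)"
    unfolding T_def q_binomial ..
  also have "(\<Sum>k\<le>2 * n + 1. T k) = (\<Sum>k\<le>n. T k) + (\<Sum>k=Suc n..n + Suc n. T k)"
    using sum_up_index_split[of T n "Suc n"] by (simp add: mult_2)
  also have "(\<Sum>k\<le>n. T k) = (\<Sum>r\<le>n. T (n - r))"
    using sum.atLeastAtMost_rev[of T 0 n] by (simp add: atLeast0AtMost)
  also have "(\<Sum>k=Suc n..n + Suc n. T k) = (\<Sum>r\<le>n. T (r + Suc n))"
    using sum.shift_bounds_cl_nat_ivl[of T 0 "Suc n" n] by (simp add: atLeast0AtMost)
  also have "F * ((\<Sum>r\<le>n. T (n - r)) + (\<Sum>r\<le>n. T (r + Suc n)))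
    = (\<Sum>r\<le>n. F * T (n - r) + F * T (r + Suc n))"
    by (simp add: sum.distrib sum_distrib_left algebra_simps)
  also have "\<dots> = Q * (\<Sum>r\<le>n. (- 1) ^ r * p ^ (r choose 2) * a ^ r * (1 - b ^ (2 * r + 1))
        / (qfac p p (n - r) * qfac p p (n + r + 1)))"
    unfolding sum_distrib_left
    by (intro sum.cong refl) (simp only: low high atMost_iff factor_out)
  finally show ?thesis
    using qfac_nonzero[OF p(1) p(1)] by (simp add: Q_def field_simps)
qed

text \<open>Limit of the finite form: the sum side tends to the series over (p; p)_inf squared, the
  product side has a single (p; p)_inf below. Since \<open>b\<close> lies in the unit disc, the
  paired terms are at most 2 |a|^r in norm.\<close>

lemma jacobi_triple:
  assumes a: "norm a < 1" "a \<noteq> 0" and b: "norm b < 1" "b \<noteq> 0" and ab: "a * b = p"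
  shows "(\<lambda>r. (- 1) ^ r * p ^ (r choose 2) * a ^ r * (1 - b ^ (2 * r + 1)))
      sums (qpoch_inf a p * qpoch_inf b p * qpoch_inf p p)" (is "?f sums _")
    and "summable (\<lambda>r. norm ((- 1) ^ r * p ^ (r choose 2) * a ^ r * (1 - b ^ (2 * r + 1))))"
proof -
  have p: "norm p < 1" "p \<noteq> 0"
    using ab a b mult_strict_mono'[of "norm a" 1 "norm b" 1] by (auto simp: norm_mult)
  show summable: "summable (\<lambda>r. norm (?f r))"
  proof (rule summable_comparison_test'[where N = 0])
    show "summable (\<lambda>r. norm a ^ r * 2)"
      using a by (intro summable_mult2 summable_geometric) simp
    fix r :: nat
    have "norm (1 - b ^ (2 * r + 1)) \<le> 1 + norm b ^ (2 * r + 1)"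
      by (metis norm_one norm_power norm_triangle_ineq4)
    also have "norm b ^ (2 * r + 1) \<le> 1" using b by (intro power_le_one) auto
    finally have "norm (1 - b ^ (2 * r + 1)) \<le> 2" by simp
    moreover have "norm p ^ (r choose 2) * norm a ^ r \<le> norm a ^ r"
      using p by (intro mult_left_le_one_le power_le_one) auto
    ultimately have "norm p ^ (r choose 2) * norm a ^ r * norm (1 - b ^ (2 * r + 1)) \<le> norm a ^ r * 2"
      by (intro mult_mono) auto
    then show "norm (norm (?f r)) \<le> norm a ^ r * 2" by (simp add: norm_mult norm_power)
  qed
  have "(\<lambda>n. qfac a p n * qfac b p (Suc n) / qfac p p (2 * n + 1)) \<longlonglongrightarrow> (\<Sum>r. ?f r) / (qpoch_inf p p)\<^sup>2"
    using tendsto_sum_over_qfac2[OF p(1) summable, of 1] unfolding jacobi_triple_finite[OF p ab] .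
  moreover have "(\<lambda>n. qfac a p n * qfac b p (Suc n) / qfac p p (2 * n + 1))
      \<longlonglongrightarrow> qpoch_inf a p * qpoch_inf b p / qpoch_inf p p"
  proof (intro tendsto_divide tendsto_mult qfac_tendsto LIMSEQ_Suc qpoch_inf_nonzero p)
    have "strict_mono (\<lambda>n :: nat. 2 * n + 1)" by (simp add: strict_mono_def)
    then show "(\<lambda>n. qfac p p (2 * n + 1)) \<longlonglongrightarrow> qpoch_inf p p"
      using LIMSEQ_subseq_LIMSEQ[OF qfac_tendsto[OF p(1), of p]] by (simp add: o_def)
  qed
  ultimately have "(\<Sum>r. ?f r) / (qpoch_inf p p)\<^sup>2 = qpoch_inf a p * qpoch_inf b p / qpoch_inf p p"
    by (rule LIMSEQ_unique)
  then have "(\<Sum>r. ?f r) = qpoch_inf a p * qpoch_inf b p * qpoch_inf p p"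
    using qpoch_inf_nonzero[OF p(1) p(1)] by (simp add: field_simps power2_eq_square)
  then show "?f sums (qpoch_inf a p * qpoch_inf b p * qpoch_inf p p)"
    using summable_sums[OF summable_norm_cancel[OF summable]] by simp
qed

lemma theta_series:
  assumes x: "norm x < 1" "x \<noteq> 0"
  shows "(\<lambda>r. if r = 0 then 1 else 2 * (- 1) ^ r * x ^ r\<^sup>2)
      sums (qpoch_inf x (x\<^sup>2) * qpoch_inf x (x\<^sup>2) * qpoch_inf (x\<^sup>2) (x\<^sup>2))" (is "?f sums ?P")
    and "summable (\<lambda>r. norm (if r = 0 then 1 else 2 * (- 1) ^ r * x ^ r\<^sup>2))"
proof -
  define t where "t r = (- 1) ^ r * x ^ r\<^sup>2" for r :: nat
  have bound: "norm x ^ r\<^sup>2 \<le> norm x ^ r" for r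
    using x by (intro power_decreasing) (auto simp: power2_nat_le_imp_le)
  have geom: "summable (\<lambda>r. norm x ^ r)" using x by (intro summable_geometric) simp
  show "summable (\<lambda>r. norm (?f r))"
    by (rule summable_comparison_test'[OF summable_mult[OF geom, of 2], where N = 0])
      (use bound in \<open>auto simp: norm_mult norm_power\<close>)
  have "summable t"
    by (rule summable_comparison_test'[OF geom, where N = 0])
      (use bound in \<open>auto simp: norm_mult norm_power t_def\<close>)
  then have t: "t sums suminf t" by (rule summable_sums)
  then have t_Suc: "(\<lambda>r. t (Suc r)) sums (suminf t - 1)"
    by (subst sums_Suc_iff) (simp add: t_def)
  \<comment> \<open>This is the triple product with both parameters \<open>x\<close> and base x^2:
    the bilateral index \<open>- r - 1\<close> has the value \<open>t (Suc r)\<close>. Summation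
    gives twice the sum of \<open>t\<close>, less its initial term 1, which is the series
    claimed.\<close>
  have "(\<lambda>r. t r + t (Suc r)) = (\<lambda>r. (- 1) ^ r * (x\<^sup>2) ^ (r choose 2) * x ^ r * (1 - x ^ (2 * r + 1)))"
  proof
    fix r :: nat
    have "x ^ r\<^sup>2 = (x\<^sup>2) ^ (r choose 2) * x ^ r"
      by (simp add: square_eq_choose_two flip: power_mult power_add)
    moreover have "x ^ (Suc r)\<^sup>2 = x ^ r\<^sup>2 * x ^ (2 * r + 1)"
      by (simp add: power2_eq_square algebra_simps mult_2_right flip: power_add)
    ultimately show "t r + t (Suc r) = (- 1) ^ r * (x\<^sup>2) ^ (r choose 2) * x ^ r * (1 - x ^ (2 * r + 1))"
      by (simp add: t_def algebra_simps)
  qed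
  then have "(\<lambda>r. t r + t (Suc r)) sums ?P"
    using jacobi_triple(1)[OF x x, of "x\<^sup>2"] by (simp add: power2_eq_square)
  then have "?P = suminf t + (suminf t - 1)"
    using sums_add[OF t t_Suc] sums_unique2 by blast
  then have "2 * (suminf t - 1) + 1 = ?P" by simp
  moreover have "(\<lambda>r. ?f (Suc r)) sums (2 * (suminf t - 1))"
    using sums_mult[OF t_Suc, of 2] by (simp add: t_def mult_ac)
  then have "?f sums (2 * (suminf t - 1) + 1)"
    by (subst (asm) sums_Suc_iff) simp
  ultimately show "?f sums ?P" by (simp only:)
qed

section \<open>The series and its recurrence\<close>

definition rr_term :: "complex \<Rightarrow> nat \<Rightarrow> nat \<Rightarrow> complex" where
  "rr_term q m n = qfac (- q) (q\<^sup>2) n * q ^ (n\<^sup>2 + 2 * m * n) / qfac (q ^ 4) (q ^ 4) n"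

lemma norm_power_less_one: "norm (q :: complex) < 1 \<Longrightarrow> 0 < k \<Longrightarrow> norm (q ^ k) < 1"
  by (simp add: norm_power power_less_one_iff)

lemma summable_norm_rr_term:
  assumes q: "norm q < 1"
  shows "summable (\<lambda>n. norm (rr_term q m n))"
proof -
  have q4: "norm (q ^ 4) < 1" using q by (rule norm_power_less_one) simp
  obtain K where K: "K > 0" "\<And>n. norm (qfac (- q) (q\<^sup>2) n) \<le> K"
    using qfac_bounded[OF norm_power2_less_one[OF q]] by blast
  obtain K' where K': "K' > 0" "\<And>n. norm (inverse (qfac (q ^ 4) (q ^ 4) n)) \<le> K'"
    using inverse_qfac_bounded[OF q4 q4] by blast
  show ?thesis
  proof (rule summable_comparison_test'[where N = 0])
    show "summable (\<lambda>n. K * norm q ^ n * K')"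
      using q by (intro summable_mult summable_mult2 summable_geometric) simp
    fix n :: nat
    have "n \<le> n\<^sup>2 + 2 * m * n" by (simp add: power2_nat_le_imp_le trans_le_add1)
    then have "norm q ^ (n\<^sup>2 + 2 * m * n) \<le> norm q ^ n"
      using q by (intro power_decreasing) auto
    then have "norm (qfac (- q) (q\<^sup>2) n) * norm q ^ (n\<^sup>2 + 2 * m * n) * norm (inverse (qfac (q ^ 4) (q ^ 4) n))
        \<le> K * norm q ^ n * K'"
      using K K' by (intro mult_mono) auto
    then show "norm (norm (rr_term q m n)) \<le> K * norm q ^ n * K'"
      by (simp add: rr_term_def divide_inverse norm_mult norm_power)
  qed
qed

text \<open>Subtract the series for \<open>m + 2\<close> from that for \<open>m\<close>: the initial
  terms cancel, and at \<open>Suc n\<close> the factor 1 - q^(4n+4) removes the last factor of the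
  denominator. Expanding the last numerator factor 1 + q^(2n+1) yields the terms for
  \<open>m + 1\<close> and \<open>m + 2\<close> at \<open>n\<close>.\<close>

lemma rr_term_recurrence:
  assumes q: "norm q < 1"
  shows "suminf (rr_term q m) = q ^ (2 * m + 1) * suminf (rr_term q (m + 1))
    + (1 + q ^ (2 * m + 2)) * suminf (rr_term q (m + 2))"
proof -
  have q4: "norm (q ^ 4) < 1" using q by (rule norm_power_less_one) simp
  note sm = summable_sums[OF summable_norm_cancel[OF summable_norm_rr_term[OF q]]]
  define d where "d n = rr_term q m n - rr_term q (m + 2) n" for n
  have "d sums (suminf (rr_term q m) - suminf (rr_term q (m + 2)))"
    unfolding d_def by (intro sums_diff sm)
  moreover have "d 0 = 0" by (simp add: d_def rr_term_def)
  ultimately have "(\<lambda>n. d (Suc n)) sums (suminf (rr_term q m) - suminf (rr_term q (m + 2)))"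
    by (subst sums_Suc_iff) simp
  moreover have "d (Suc n) = q ^ (2 * m + 1) * rr_term q (m + 1) n + q ^ (2 * m + 2) * rr_term q (m + 2) n" for n
  proof -
    have nz: "qfac (q ^ 4) (q ^ 4) n \<noteq> 0" "1 - q ^ 4 * (q ^ 4) ^ n \<noteq> 0"
      using qfac_nonzero[OF q4 q4, of "Suc n"] by (auto simp: qfac_Suc)
    have "(Suc n)\<^sup>2 + 2 * (m + 2) * Suc n = (Suc n)\<^sup>2 + 2 * m * Suc n + (4 + 4 * n)"
      by (simp add: algebra_simps)
    then have "q ^ ((Suc n)\<^sup>2 + 2 * (m + 2) * Suc n) = q ^ ((Suc n)\<^sup>2 + 2 * m * Suc n) * (q ^ 4 * (q ^ 4) ^ n)"
      by (simp only: power_add power_mult)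
    then have "d (Suc n) = qfac (- q) (q\<^sup>2) (Suc n) * q ^ ((Suc n)\<^sup>2 + 2 * m * Suc n) * (1 - q ^ 4 * (q ^ 4) ^ n)
        / qfac (q ^ 4) (q ^ 4) (Suc n)"
      unfolding d_def rr_term_def by (simp add: right_diff_distrib diff_divide_distrib mult.assoc)
    also have "\<dots> = qfac (- q) (q\<^sup>2) n * ((1 + q * (q\<^sup>2) ^ n) * q ^ ((Suc n)\<^sup>2 + 2 * m * Suc n)) / qfac (q ^ 4) (q ^ 4) n"
      using nz by (simp add: qfac_Suc)
    also have "(1 + q * (q\<^sup>2) ^ n) * q ^ ((Suc n)\<^sup>2 + 2 * m * Suc n)
        = q ^ (2 * m + 1) * q ^ (n\<^sup>2 + 2 * (m + 1) * n) + q ^ (2 * m + 2) * q ^ (n\<^sup>2 + 2 * (m + 2) * n)"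
      by (simp add: distrib_right power2_eq_square algebra_simps flip: power_add power_mult power_Suc)
    finally show ?thesis by (simp add: rr_term_def distrib_left add_divide_distrib mult_ac)
  qed
  moreover have "(\<lambda>n. q ^ (2 * m + 1) * rr_term q (m + 1) n + q ^ (2 * m + 2) * rr_term q (m + 2) n)
    sums (q ^ (2 * m + 1) * suminf (rr_term q (m + 1)) + q ^ (2 * m + 2) * suminf (rr_term q (m + 2)))"
    by (intro sums_add sums_mult sm)
  ultimately have "suminf (rr_term q m) - suminf (rr_term q (m + 2))
    = q ^ (2 * m + 1) * suminf (rr_term q (m + 1)) + q ^ (2 * m + 2) * suminf (rr_term q (m + 2))"
    using sums_unique2 by simp
  then show ?thesis by (simp add: algebra_simps)
qed

text \<open>Bailey's lemma with the even pair: the two numerator factorials join to (-q; q^2)_L, and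
  the exponents 2 r^2 and r^2 add up to the theta series in q^3.\<close>

lemma suminf_rr_term_0:
  assumes q: "norm q < 1" "q \<noteq> 0"
  shows "suminf (rr_term q 0) = qpoch_inf_multi [q ^ 3, q ^ 3, q ^ 6] (q ^ 6) * qpoch_inf (- q) (q\<^sup>2)
    / qpoch_inf (q\<^sup>2) (q\<^sup>2)"
proof -
  define \<alpha> where "\<alpha> r = (if r = 0 then 1 else 2 * (- 1) ^ r * (q\<^sup>2) ^ r\<^sup>2)" for r :: nat
  define g where "g r = (if r = 0 then 1 else 2 * (- 1) ^ r * (q ^ 3) ^ r\<^sup>2)" for r :: nat
  have q3: "norm (q ^ 3) < 1" "q ^ 3 \<noteq> 0" using q by (auto intro: norm_power_less_one)
  have p2: "(q\<^sup>2)\<^sup>2 = q ^ 4" "(q ^ 3)\<^sup>2 = q ^ 6" by (simp_all flip: power_mult)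
  have term_eq: "qfac (- q) (q\<^sup>2) j * q ^ (j\<^sup>2 + 2 * 0 * j) * (1 / qfac ((q\<^sup>2)\<^sup>2) ((q\<^sup>2)\<^sup>2) j) = rr_term q 0 j" for j
    by (simp add: rr_term_def p2)
  have "(\<Sum>j. qfac (- q) (q\<^sup>2) j * q ^ (j\<^sup>2 + 2 * 0 * j) * (1 / qfac ((q\<^sup>2)\<^sup>2) ((q\<^sup>2)\<^sup>2) j))
      = qpoch_inf (- q) (q\<^sup>2) / qpoch_inf (q\<^sup>2) (q\<^sup>2) * (\<Sum>r. g r)"
  proof (rule bailey_limit[OF q(1), where \<alpha> = \<alpha>])
    show "(\<Sum>r\<le>n. \<alpha> r / (qfac (q\<^sup>2) (q\<^sup>2) (n - r) * qfac (q\<^sup>2) (q\<^sup>2) (n + r + 0))) = 1 / qfac ((q\<^sup>2)\<^sup>2) ((q\<^sup>2)\<^sup>2) n" for n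
      using bailey_pair_even[OF norm_power2_less_one[OF q(1)], of n] by (simp add: \<alpha>_def)
    show "\<alpha> r * (qfac (- q) (q\<^sup>2) r * qfac (- (q ^ (2 * r + 1 + 2 * 0))) (q\<^sup>2) (L - r) * q ^ (r\<^sup>2 + 2 * 0 * r))
        = qfac (- q) (q\<^sup>2) (L + 0) * g r" if "r \<le> L" for r L
    proof -
      have "qfac (- q) (q\<^sup>2) L = qfac (- q) (q\<^sup>2) r * qfac (- (q ^ (2 * r + 1))) (q\<^sup>2) (L - r)"
        using qfac_add[of "- q" "q\<^sup>2" r "L - r"] that by (simp add: power_mult)
      moreover have "\<alpha> r * q ^ r\<^sup>2 = g r"
        by (simp add: \<alpha>_def g_def flip: power_mult power_add)
      ultimately show ?thesis by (simp add: mult_ac)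
    qed
    show "summable (\<lambda>r. norm (g r))" unfolding g_def by (rule theta_series(2)[OF q3])
  qed (unfold term_eq, rule summable_norm_rr_term[OF q(1)])
  moreover have "(\<Sum>r. g r) = qpoch_inf (q ^ 3) (q ^ 6) * qpoch_inf (q ^ 3) (q ^ 6) * qpoch_inf (q ^ 6) (q ^ 6)"
    using sums_unique[OF theta_series(1)[OF q3]] unfolding g_def p2 by simp
  ultimately show ?thesis unfolding term_eq by (simp add: qpoch_inf_multi_def mult_ac)
qed

text \<open>Bailey's lemma with the odd pair: the factor 1 + q^(2r+1) of 1 - q^(4r+2) completes the
  numerator to (-q; q^2)_(L+1), and 1 - q^(2r+1) remains as the bracket of the triple product with
  parameters q^5 and q.\<close>

lemma suminf_rr_term_1:
  assumes q: "norm q < 1" "q \<noteq> 0"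
  shows "suminf (rr_term q 1) = qpoch_inf (q ^ 6) (q ^ 6)
    / (qpoch_inf (q ^ 4) (q ^ 4) * qpoch_inf_multi [q ^ 3, q ^ 9] (q ^ 12))"
proof -
  define \<alpha> where "\<alpha> r = (- 1) ^ r * (q\<^sup>2) ^ r\<^sup>2 * (1 - (q\<^sup>2) ^ (2 * r + 1))" for r :: nat
  define g where "g r = (- 1) ^ r * (q ^ 6) ^ (r choose 2) * (q ^ 5) ^ r * (1 - q ^ (2 * r + 1))" for r :: nat
  note small = norm_power_less_one[OF q(1)]
  have p2: "(q\<^sup>2)\<^sup>2 = q ^ 4" by (simp flip: power_mult)
  have term_eq: "qfac (- q) (q\<^sup>2) j * q ^ (j\<^sup>2 + 2 * 1 * j) * (1 / qfac ((q\<^sup>2)\<^sup>2) ((q\<^sup>2)\<^sup>2) j) = rr_term q 1 j" for j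
    by (simp add: rr_term_def p2)
  have q5: "norm (q ^ 5) < 1" "q ^ 5 \<noteq> 0" "q ^ 5 * q = q ^ 6"
    using q small[of 5] by (simp_all flip: power_Suc2)
  note triple = jacobi_triple[OF q5(1,2) q q5(3)]
  have "(\<Sum>j. qfac (- q) (q\<^sup>2) j * q ^ (j\<^sup>2 + 2 * 1 * j) * (1 / qfac ((q\<^sup>2)\<^sup>2) ((q\<^sup>2)\<^sup>2) j))
      = qpoch_inf (- q) (q\<^sup>2) / qpoch_inf (q\<^sup>2) (q\<^sup>2) * (\<Sum>r. g r)"
  proof (rule bailey_limit[OF q(1), where \<alpha> = \<alpha>])
    show "(\<Sum>r\<le>n. \<alpha> r / (qfac (q\<^sup>2) (q\<^sup>2) (n - r) * qfac (q\<^sup>2) (q\<^sup>2) (n + r + 1))) = 1 / qfac ((q\<^sup>2)\<^sup>2) ((q\<^sup>2)\<^sup>2) n" for n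
      using bailey_pair_odd[OF norm_power2_less_one[OF q(1)], of n] by (simp add: \<alpha>_def)
    show "\<alpha> r * (qfac (- q) (q\<^sup>2) r * qfac (- (q ^ (2 * r + 1 + 2 * 1))) (q\<^sup>2) (L - r) * q ^ (r\<^sup>2 + 2 * 1 * r))
        = qfac (- q) (q\<^sup>2) (L + 1) * g r" if "r \<le> L" for r L
    proof -
      have "- q * (q\<^sup>2) ^ Suc r = - (q ^ (2 * r + 1 + 2 * 1))"
        by (simp add: power_mult power2_eq_square)
      then have "qfac (- q) (q\<^sup>2) (Suc r + (L - r))
          = qfac (- q) (q\<^sup>2) (Suc r) * qfac (- (q ^ (2 * r + 1 + 2 * 1))) (q\<^sup>2) (L - r)"
        by (simp only: qfac_add)
      also have "qfac (- q) (q\<^sup>2) (Suc r) = qfac (- q) (q\<^sup>2) r * (1 + q ^ (2 * r + 1))"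
        by (simp add: qfac_Suc power_mult)
      also have "Suc r + (L - r) = L + 1" using that by simp
      finally have fac: "qfac (- q) (q\<^sup>2) (L + 1) = qfac (- q) (q\<^sup>2) r * (1 + q ^ (2 * r + 1))
          * qfac (- (q ^ (2 * r + 1 + 2 * 1))) (q\<^sup>2) (L - r)" .
      have factor: "1 - (q\<^sup>2) ^ (2 * r + 1) = (1 + q ^ (2 * r + 1)) * (1 - q ^ (2 * r + 1))"
        by (simp add: algebra_simps mult_2_right power_add power2_eq_square power_mult_distrib)
      have pow: "(q\<^sup>2) ^ r\<^sup>2 * q ^ (r\<^sup>2 + 2 * 1 * r) = (q ^ 6) ^ (r choose 2) * (q ^ 5) ^ r"
      proof -
        have "2 * r\<^sup>2 + (r\<^sup>2 + 2 * 1 * r) = 6 * (r choose 2) + 5 * r"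
          by (simp add: square_eq_choose_two)
        then show ?thesis by (simp only: flip: power_mult power_add)
      qed
      have "\<alpha> r * (qfac (- q) (q\<^sup>2) r * qfac (- (q ^ (2 * r + 1 + 2 * 1))) (q\<^sup>2) (L - r) * q ^ (r\<^sup>2 + 2 * 1 * r))
          = ((q\<^sup>2) ^ r\<^sup>2 * q ^ (r\<^sup>2 + 2 * 1 * r)) * ((- 1) ^ r * (1 - (q\<^sup>2) ^ (2 * r + 1))
            * (qfac (- q) (q\<^sup>2) r * qfac (- (q ^ (2 * r + 1 + 2 * 1))) (q\<^sup>2) (L - r)))"
        unfolding \<alpha>_def by (simp only: mult_ac)
      then show ?thesis
        unfolding pow factor fac g_def by (simp only: mult_ac)
    qed
    show "summable (\<lambda>r. norm (g r))" unfolding g_def by (rule triple(2))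
  qed (unfold term_eq, rule summable_norm_rr_term[OF q(1)])
  moreover have "(\<Sum>r. g r) = qpoch_inf (q ^ 5) (q ^ 6) * qpoch_inf q (q ^ 6) * qpoch_inf (q ^ 6) (q ^ 6)"
    using sums_unique[OF triple(1)] unfolding g_def by simp
  ultimately have S: "suminf (rr_term q 1) = qpoch_inf (- q) (q\<^sup>2) / qpoch_inf (q\<^sup>2) (q\<^sup>2)
      * (qpoch_inf (q ^ 5) (q ^ 6) * qpoch_inf q (q ^ 6) * qpoch_inf (q ^ 6) (q ^ 6))"
    unfolding term_eq by simp
  \<comment> \<open>The remaining task is a product identity. The missing residue class 3 modulo 6
    is supplied to reassemble (q; q^2)_inf, which joins (-q; q^2)_inf into (q^2; q^4)_inf and
    cancels against the denominator.\<close>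
  have d1: "qpoch_inf q (q\<^sup>2) = qpoch_inf q (q ^ 6) * qpoch_inf (q ^ 3) (q ^ 6) * qpoch_inf (q ^ 5) (q ^ 6)"
    using qpoch_inf_dissect3[OF small[of 2], of q]
    by (simp add: eval_nat_numeral mult_ac)
  have d2: "qpoch_inf (q\<^sup>2) (q\<^sup>2) = qpoch_inf (q\<^sup>2) (q ^ 4) * qpoch_inf (q ^ 4) (q ^ 4)"
    using qpoch_inf_dissect2[OF small[of 2], of "q\<^sup>2"] by (simp add: eval_nat_numeral mult_ac)
  have d3: "qpoch_inf (q ^ 3) (q ^ 6) = qpoch_inf_multi [q ^ 3, q ^ 9] (q ^ 12)"
    using qpoch_inf_dissect2[OF small[of 6], of "q ^ 3"]
    by (simp add: qpoch_inf_multi_def flip: power_add power_mult)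
  have d4: "qpoch_inf q (q\<^sup>2) * qpoch_inf (- q) (q\<^sup>2) = qpoch_inf (q\<^sup>2) (q ^ 4)"
  proof (rule LIMSEQ_unique)
    show "(\<lambda>n. qfac q (q\<^sup>2) n * qfac (- q) (q\<^sup>2) n) \<longlonglongrightarrow> qpoch_inf q (q\<^sup>2) * qpoch_inf (- q) (q\<^sup>2)"
      by (intro tendsto_mult qfac_tendsto small) simp_all
    have "(q ^ 4) ^ k = (q\<^sup>2) ^ k * (q\<^sup>2) ^ k" for k
      unfolding p2 [symmetric] by (simp add: power2_eq_square power_mult_distrib)
    moreover have "(1 - q * w) * (1 - - q * w) = 1 - q\<^sup>2 * (w * w)" for w
      by algebra
    ultimately have "qfac q (q\<^sup>2) n * qfac (- q) (q\<^sup>2) n = qfac (q\<^sup>2) (q ^ 4) n" for n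
      unfolding qfac_def prod.distrib [symmetric] by (simp only:)
    then show "(\<lambda>n. qfac q (q\<^sup>2) n * qfac (- q) (q\<^sup>2) n) \<longlonglongrightarrow> qpoch_inf (q\<^sup>2) (q ^ 4)"
      using qfac_tendsto[OF small[of 4], of "q\<^sup>2"] by simp
  qed
  have nz: "qpoch_inf (q\<^sup>2) (q ^ 4) \<noteq> 0" "qpoch_inf (q ^ 4) (q ^ 4) \<noteq> 0" "qpoch_inf (q ^ 3) (q ^ 6) \<noteq> 0"
    by (intro qpoch_inf_nonzero small; simp)+
  have "qpoch_inf (- q) (q\<^sup>2) * (qpoch_inf (q ^ 5) (q ^ 6) * qpoch_inf q (q ^ 6)) * qpoch_inf (q ^ 3) (q ^ 6)
      = qpoch_inf (q\<^sup>2) (q ^ 4)"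
    unfolding d4 [symmetric] d1 by (simp only: mult_ac)
  then have "qpoch_inf (- q) (q\<^sup>2) * (qpoch_inf (q ^ 5) (q ^ 6) * qpoch_inf q (q ^ 6))
      = qpoch_inf (q\<^sup>2) (q ^ 4) / qpoch_inf (q ^ 3) (q ^ 6)"
    using nz by (simp add: eq_divide_eq)
  moreover have "suminf (rr_term q 1) = qpoch_inf (- q) (q\<^sup>2) * (qpoch_inf (q ^ 5) (q ^ 6) * qpoch_inf q (q ^ 6))
      * qpoch_inf (q ^ 6) (q ^ 6) / qpoch_inf (q\<^sup>2) (q\<^sup>2)"
    unfolding S by simp
  ultimately have "suminf (rr_term q 1) = qpoch_inf (q\<^sup>2) (q ^ 4) / qpoch_inf (q ^ 3) (q ^ 6)
      * qpoch_inf (q ^ 6) (q ^ 6) / (qpoch_inf (q\<^sup>2) (q ^ 4) * qpoch_inf (q ^ 4) (q ^ 4))"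
    unfolding d2 by (simp only:)
  also have "\<dots> = qpoch_inf (q ^ 6) (q ^ 6) / (qpoch_inf (q ^ 4) (q ^ 4) * qpoch_inf (q ^ 3) (q ^ 6))"
    using nz by simp
  finally show ?thesis unfolding d3 .
qed

section \<open>Matching the normalized series with the recurrence and its initial values\<close>

theorem theorem2p8:
  fixes q :: complex and A B :: "nat \<Rightarrow> complex" and m :: nat
  assumes q: "0 < norm q" "norm q < 1"
    and A_init: "A 0 = 0" "A 1 = 1"
    and A_rec: "\<And>m. m \<ge> 2 \<Longrightarrow>
      A m = - (q ^ (2 * m - 3)) * A (m - 1) + (1 + q ^ (2 * m - 4)) * A (m - 2)"
    and B_init: "B 0 = - (1 / 2)" "B 1 = 0"
    and B_rec: "\<And>m. m \<ge> 2 \<Longrightarrow>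
      B m = - (q ^ (2 * m - 3)) * B (m - 1) + (1 + q ^ (2 * m - 4)) * B (m - 2)"
  shows "(\<lambda>n. qpoch (- q) (q ^ 2) (int n) * q ^ (n ^ 2 + 2 * m * n) / qpoch (q ^ 4) (q ^ 4) (int n))
    sums
      (qpoch_inf (q ^ 6) (q ^ 6)
         / (qpoch (- (q ^ 2)) (q ^ 2) (int m - 1) * qpoch_inf (q ^ 4) (q ^ 4)
            * qpoch_inf_multi [q ^ 3, q ^ 9] (q ^ 12)) * A m
       - qpoch_inf_multi [q ^ 3, q ^ 3, q ^ 6] (q ^ 6) * qpoch_inf (- q) (q ^ 2)
         / (qpoch (- (q ^ 2)) (q ^ 2) (int m - 1) * qpoch_inf (q ^ 2) (q ^ 2)) * B m)"
proof -
  have q0: "q \<noteq> 0" using q by auto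
  note small = norm_power_less_one[OF q(2)]
  define S where "S k = suminf (rr_term q k)" for k
  define D where "D k = qpoch (- (q ^ 2)) (q ^ 2) (int k - 1)" for k
  define X where "X = qpoch_inf (q ^ 6) (q ^ 6) / (qpoch_inf (q ^ 4) (q ^ 4) * qpoch_inf_multi [q ^ 3, q ^ 9] (q ^ 12))"
  define Y where "Y = qpoch_inf_multi [q ^ 3, q ^ 3, q ^ 6] (q ^ 6) * qpoch_inf (- q) (q ^ 2) / qpoch_inf (q ^ 2) (q ^ 2)"
  have D0: "D 0 = 1 / 2"
    using qpoch_minus_one[of "q\<^sup>2"] q0 small[of 2] by (simp add: D_def)
  have D_Suc: "D (Suc k) = qfac (- (q\<^sup>2)) (q\<^sup>2) k" for k
    using qpoch_eq_qfac[of "- (q\<^sup>2)" "q\<^sup>2" k] small[of 2] by (simp add: D_def)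
  \<comment> \<open>At \<open>k = 0\<close> this reads 1 = 2 * (1/2), so the value at index -1 fits
    the same rule.\<close>
  have D_rec: "D (Suc k) = (1 + q ^ (2 * k)) * D k" for k
    unfolding power_mult by (cases k) (simp_all add: D0 D_Suc qfac_Suc mult.commute)
  have D_nonzero: "D k \<noteq> 0" for k
    using qfac_nonzero[of "- (q\<^sup>2)" "q\<^sup>2"] small[of 2] by (cases k) (simp_all add: D0 D_Suc)
  have "S k * D k = X * A k - Y * B k \<and> S (Suc k) * D (Suc k) = X * A (Suc k) - Y * B (Suc k)" for k
  proof (induction k)
    case 0
    \<comment> \<open>The value -1/2 of \<open>B 0\<close> absorbs the factor
      \<open>D 0 = 1/2\<close>; \<open>A 0\<close> and \<open>B 1\<close> remove the other product
      in each case.\<close>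
    have "S 0 = Y" "S 1 = X"
      using suminf_rr_term_0[OF q(2) q0] suminf_rr_term_1[OF q(2) q0] by (simp_all add: S_def X_def Y_def)
    then show ?case using A_init B_init by (simp add: D0 D_Suc)
  next
    case (Suc k)
    have rec: "A (Suc (Suc k)) = - (q ^ (2 * k + 1)) * A (Suc k) + (1 + q ^ (2 * k)) * A k"
      "B (Suc (Suc k)) = - (q ^ (2 * k + 1)) * B (Suc k) + (1 + q ^ (2 * k)) * B k"
      using A_rec[of "k + 2"] B_rec[of "k + 2"] by simp_all
    \<comment> \<open>The coefficient of \<open>S (Suc (Suc k))\<close> in the series recurrence is
      exactly the quotient of consecutive values of \<open>D\<close>.\<close>
    have "S (Suc (Suc k)) * D (Suc (Suc k)) = (S k - q ^ (2 * k + 1) * S (Suc k)) * D (Suc k)"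
      using rr_term_recurrence[OF q(2), of k] D_rec[of "Suc k"] by (simp add: S_def)
    also have "\<dots> = (1 + q ^ (2 * k)) * (S k * D k) - q ^ (2 * k + 1) * (S (Suc k) * D (Suc k))"
      unfolding left_diff_distrib D_rec[of k] by (simp only: mult_ac)
    also have "\<dots> = X * A (Suc (Suc k)) - Y * B (Suc (Suc k))"
      unfolding conjunct1[OF Suc] conjunct2[OF Suc] rec by (simp add: algebra_simps)
    finally show ?case using Suc by simp
  qed
  then have "S m * D m = X * A m - Y * B m" by blast
  then have "S m = (X * A m - Y * B m) / D m"
    by (simp only: nonzero_eq_divide_eq[OF D_nonzero])
  then have "S m = X / D m * A m - Y / D m * B m"
    by (simp only: diff_divide_distrib times_divide_eq_left)
  also have "X / D m = qpoch_inf (q ^ 6) (q ^ 6)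
      / (D m * qpoch_inf (q ^ 4) (q ^ 4) * qpoch_inf_multi [q ^ 3, q ^ 9] (q ^ 12))"
    unfolding X_def divide_divide_eq_left by (simp only: mult_ac)
  also have "Y / D m = qpoch_inf_multi [q ^ 3, q ^ 3, q ^ 6] (q ^ 6) * qpoch_inf (- q) (q ^ 2)
      / (D m * qpoch_inf (q ^ 2) (q ^ 2))"
    unfolding Y_def divide_divide_eq_left by (simp only: mult_ac)
  finally have "S m = qpoch_inf (q ^ 6) (q ^ 6)
      / (D m * qpoch_inf (q ^ 4) (q ^ 4) * qpoch_inf_multi [q ^ 3, q ^ 9] (q ^ 12)) * A m
    - qpoch_inf_multi [q ^ 3, q ^ 3, q ^ 6] (q ^ 6) * qpoch_inf (- q) (q ^ 2)
      / (D m * qpoch_inf (q ^ 2) (q ^ 2)) * B m" .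
  moreover have "rr_term q m sums S m"
    unfolding S_def by (rule summable_sums[OF summable_norm_cancel[OF summable_norm_rr_term[OF q(2)]]])
  moreover have "rr_term q m
    = (\<lambda>n. qpoch (- q) (q ^ 2) (int n) * q ^ (n ^ 2 + 2 * m * n) / qpoch (q ^ 4) (q ^ 4) (int n))"
    using q small[of 2] small[of 4] by (simp add: rr_term_def fun_eq_iff qpoch_eq_qfac)
  ultimately show ?thesis
    by (simp only: D_def)
qed

end
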